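(* For any $\phi\in \mathcal F_{N}$ there exist a polynomial $s\in \mathbb C[z,w]$ and a function $g$ on $\sigma(\Theta(N))$ with values in $\mathbb C$ on $\sigma(\Theta(N))\setminus (Z^{\mathbb R}_p + i Z^{\mathbb R}_q)$ and values in $\mathbb C^2$ on $\sigma(\Theta(N))\cap (Z^{\mathbb R}_p + i Z^{\mathbb R}_q)$ such that $\phi - s_N\in \mathcal R$, such that $g$ is bounded and measurable on $\sigma(\Theta(N))\setminus (Z^{\mathbb R}_p + i Z^{\mathbb R}_q)$, and such that $$\phi(z) = s_N(z) + (p_N + q_N)(z)\cdot g(z), \quad z \in \sigma(\Theta(N)),$$ where $(p_N+q_N)(z)\cdot g(z)$ is the product described in the context.
   Context: Setting. For bounded linear operators between Krein or Hilbert spaces, ${}^*$ denotes the adjoint with respect to the given inner products; $C'$ is the commutant of an operator $C$ in the algebra of bounded operators. A bounded linear operator $N$ on a Krein space $(\mathcal K,[.,.])$ is normal if $NN^*=N^*N$; put $A:=\frac{N+N^*}{2}$, $B:=\frac{N-N^*}{2i}$. A normal $N$ is definitizable if there are nonzero real polynomials $p,q\in\mathbb R[z]$ with $[p(A)x,x]\ge 0$ and $[q(B)x,x]\ge 0$ for all $x\in\mathcal K$. Fix a bounded normal definitizable $N$ and such $p,q$. Let $\mathcal V_1,\mathcal V_2,\mathcal V$ be Hilbert spaces and $T_1:\mathcal V_1\to\mathcal K$, $T_2:\mathcal V_2\to\mathcal K$, $T:\mathcal V\to\mathcal K$ bounded linear injective maps with $T_1T_1^*=p(A)$, $T_2T_2^*=q(B)$,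 $TT^*=p(A)+q(B)$ (these exist: e.g. $\mathcal V$ is the completion of $\mathcal K/\ker(p(A)+q(B))$ with respect to $[(p(A)+q(B)).,.]$ and $T$ is the adjoint of the canonical map $\mathcal K\to\mathcal V$; similarly for $T_1,T_2$ with $p(A)$, $q(B)$). For $C\in(TT^* )'$ let $\Theta(C)=T^{-1}CT$, i.e. the bounded operator on $\mathcal V$ determined by $T\Theta(C)=CT$; $\Theta:(TT^* )'\to(T^*T)'$ is a unital $*$-homomorphism. Then $\Theta(N)$ is a normal operator on the Hilbert space $\mathcal V$. Function classes. For $m,n\in\mathbb N$ (positive) let $I_{m,n}:=(\{0,\dots,m-1\}\times\{0,\dots,n-1\})\cup\{(m,0),(0,n)\}$, let $\mathcal A_{m,n}$ be the space of families $(a_{k,l})_{(k,l)\in I_{m,n}}$ of complex numbers and $\mathcal B_{m,n}$ the space of families indexed by $\{0,\dots,m-1\}\times\{0,\dots,n-1\}$, with componentwise addition, scalar multiplication and conjugation $\overline a=(\bar a_{k,l})$, and with multiplication $(a\cdot b)_{k,l}=\sum_{c=0}^k\sum_{d=0}^l a_{c,d}b_{k-c,l-d}$. They are commutative unital $*$-algebras. $\pi:\mathcal A_{m,n}\to\mathcal B_{m,n}$ drops the entries with indices $(m,0),(0,n)$; on $\mathcal B_{m,n}$, $\pi$ is the identity. Let $\mathfrak d_p(z)$, $\mathfrak d_q(z)$ be the multiplicity of $z\in\mathbb C$ as a zero of $p$, $q$; $Z^{\mathbb R}_p:=p^{-1}\{0\}\cap\mathbb R$, $Z^{\mathbb R}_q:=q^{-1}\{0\}\cap\mathbb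 R$, $Z^{\mathbb R}_p+iZ^{\mathbb R}_q:=\{x+iy: x\in Z^{\mathbb R}_p,y\in Z^{\mathbb R}_q\}$, $Z^i:=(p^{-1}\{0\}\times q^{-1}\{0\})\setminus(\mathbb R\times\mathbb R)\subseteq\mathbb C^2$. Put $\mathfrak C(z):=\mathbb C$ for $z\in\sigma(\Theta(N))\setminus(Z^{\mathbb R}_p+iZ^{\mathbb R}_q)$, $\mathfrak C(z):=\mathcal A_{\mathfrak d_p(\operatorname{Re}z),\mathfrak d_q(\operatorname{Im}z)}$ for $z\in Z^{\mathbb R}_p+iZ^{\mathbb R}_q$, $\mathfrak C(\xi,\eta):=\mathcal B_{\mathfrak d_p(\xi),\mathfrak d_q(\eta)}$ for $(\xi,\eta)\in Z^i$. $\mathcal M_N$ is the set of functions $\phi$ on $\big(\sigma(\Theta(N))\cup(Z^{\mathbb R}_p+iZ^{\mathbb R}_q)\big)\,\dot\cup\, Z^i$ with $\phi(z)\in\mathfrak C(z)$, with pointwise algebra operations. $\mathcal R$ is the set of $\phi\in\mathcal M_N$ with $\pi(\phi(z))=0$ for all $z\in(Z^{\mathbb R}_p+iZ^{\mathbb R}_q)\,\dot\cup\, Z^i$. $\mathcal F_N$ is the set of $\phi\in\mathcal M_N$ that are Borel measurable and bounded on $\sigma(\Theta(N))\setminus(Z^{\mathbb R}_p+iZ^{\mathbb R}_q)$ and such that for each $w\in\sigma(\Theta(N))\cap(Z^{\mathbb R}_p+iZ^{\mathbb R}_q)$ the quotient $$\frac{\phi(z)-\sum_{k=0}^{\mathfrak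 d_p(\operatorname{Re}w)-1}\sum_{l=0}^{\mathfrak d_q(\operatorname{Im}w)-1}\phi(w)_{k,l}\operatorname{Re}(z-w)^k\operatorname{Im}(z-w)^l}{\max(|\operatorname{Re}(z-w)|^{\mathfrak d_p(\operatorname{Re}w)},|\operatorname{Im}(z-w)|^{\mathfrak d_q(\operatorname{Im}w)})}$$ is bounded for $z\in\sigma(\Theta(N))\cap U(w)\setminus\{w\}$, where $U(w)$ is a sufficiently small neighbourhood of $w$. A polynomial $s\in\mathbb C[z,w]$ gives $s_N\in\mathcal M_N$: $s_N(z)=s(\operatorname{Re}z,\operatorname{Im}z)$ for $z\in\sigma(\Theta(N))\setminus(Z^{\mathbb R}_p+iZ^{\mathbb R}_q)$; $s_N(z)_{k,l}=\frac1{k!l!}\frac{\partial^{k+l}s}{\partial x^k\partial y^l}(\operatorname{Re}z,\operatorname{Im}z)$, $(k,l)\in I_{\mathfrak d_p(\operatorname{Re}z),\mathfrak d_q(\operatorname{Im}z)}$, for $z\in Z^{\mathbb R}_p+iZ^{\mathbb R}_q$; $s_N(\xi,\eta)_{k,l}=\frac1{k!l!}\frac{\partial^{k+l}s}{\partial z^k\partial w^l}(\xi,\eta)$, $0\le k<\mathfrak d_p(\xi)$, $0\le l<\mathfrak d_q(\eta)$, for $(\xi,\eta)\in Z^i$. $p_N$ and $q_N$ are obtained from $p(z)$ and $q(w)$ regarded as elements of $\mathbb C[z,w]$. Product $(p_N+q_N)(z)\cdot g(z)$: for $z\in\sigma(\Theta(N))\setminus(Z^{\mathbb R}_p+iZ^{\mathbb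 R}_q)$ it is the usual product $(p(\operatorname{Re}z)+q(\operatorname{Im}z))g(z)$ in $\mathbb C$; for $z\in\sigma(\Theta(N))\cap(Z^{\mathbb R}_p+iZ^{\mathbb R}_q)$ and $g(z)=(g(z)_1,g(z)_2)\in\mathbb C^2$ it is the element of $\mathfrak C(z)$ whose entries with $0\le k<\mathfrak d_p(\operatorname{Re}z)$, $0\le l<\mathfrak d_q(\operatorname{Im}z)$ are $0$, whose $(\mathfrak d_p(\operatorname{Re}z),0)$ entry is $(p_N+q_N)(z)_{\mathfrak d_p(\operatorname{Re}z),0}\,g(z)_1$ and whose $(0,\mathfrak d_q(\operatorname{Im}z))$ entry is $(p_N+q_N)(z)_{0,\mathfrak d_q(\operatorname{Im}z)}\,g(z)_2$. *)

theory Defs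
  imports "HOL-Analysis.Analysis" "HOL-Computational_Algebra.Polynomial"
begin

section \<open>Krein spaces, Hilbert spaces and their operators\<close>

class complex_vector = real_vector +
  fixes scaleC :: "complex \<Rightarrow> 'a \<Rightarrow> 'a"  (infixr "*\<^sub>C" 75)
  assumes scaleC_add_right: "a *\<^sub>C (x + y) = a *\<^sub>C x + a *\<^sub>C y"
    and scaleC_add_left: "(a + b) *\<^sub>C x = a *\<^sub>C x + b *\<^sub>C x"
    and scaleC_scaleC: "a *\<^sub>C (b *\<^sub>C x) = (a * b) *\<^sub>C x"
    and scaleC_one: "1 *\<^sub>C x = x"
    and scaleR_scaleC: "r *\<^sub>R x = complex_of_real r *\<^sub>C x"

class complex_normed_vector = complex_vector + real_normed_vector +
  assumes norm_scaleC: "norm (a *\<^sub>C x) = cmod a * norm x"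

class complex_form_space = complex_normed_vector +
  fixes ip :: "'a \<Rightarrow> 'a \<Rightarrow> complex"
  assumes ip_add_left: "ip (x + y) z = ip x z + ip y z"
    and ip_scaleC_left: "ip (a *\<^sub>C x) y = a * ip x y"
    and ip_commute: "ip x y = cnj (ip y x)"

definition (in complex_vector) csubspace :: "'a set \<Rightarrow> bool" where
  "csubspace S \<longleftrightarrow> 0 \<in> S \<and> (\<forall>x\<in>S. \<forall>y\<in>S. x + y \<in> S) \<and> (\<forall>c. \<forall>x\<in>S. c *\<^sub>C x \<in> S)"

text \<open>\<open>H\<close> with the inner product \<open>f\<close> is a Hilbert space.\<close>

definition (in complex_vector) hilbert_on :: "('a \<Rightarrow> 'a \<Rightarrow> complex) \<Rightarrow> 'a set \<Rightarrow> bool" where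
  "hilbert_on f H \<longleftrightarrow>
     csubspace H \<and> (\<forall>u\<in>H. u \<noteq> 0 \<longrightarrow> 0 < Re (f u u)) \<and>
     (\<forall>X. (\<forall>n::nat. X n \<in> H) \<and>
          (\<forall>e>0. \<exists>n0. \<forall>m\<ge>n0. \<forall>n\<ge>n0. Re (f (X m - X n) (X m - X n)) < e) \<longrightarrow>
          (\<exists>x\<in>H. (\<lambda>n. Re (f (X n - x) (X n - x))) \<longlonglongrightarrow> 0))"

text \<open>
  A Krein space carries no canonical norm, but all norms coming from fundamental decompositions
  are equivalent. The norm of a type of class \<open>krein_space\<close> is any norm inducing this topology:
  the last conjunct below says that it is equivalent to the Hilbert space norm
  \<open>sqrt ([u,u] - [v,v])\<close> of the decomposition.
\<close>

definition (in complex_form_space) fundamental_decomposition :: "'a set \<Rightarrow> 'a set \<Rightarrow> bool" where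
  "fundamental_decomposition P M \<longleftrightarrow>
     hilbert_on ip P \<and> hilbert_on (\<lambda>x y. - ip x y) M \<and>
     P \<inter> M = {0} \<and> (\<forall>x. \<exists>u\<in>P. \<exists>v\<in>M. x = u + v) \<and> (\<forall>u\<in>P. \<forall>v\<in>M. ip u v = 0) \<and>
     (\<exists>c>0. \<exists>C>0. \<forall>u\<in>P. \<forall>v\<in>M.
        c * (norm (u + v))\<^sup>2 \<le> Re (ip u u) - Re (ip v v) \<and>
        Re (ip u u) - Re (ip v v) \<le> C * (norm (u + v))\<^sup>2)"

class krein_space = complex_form_space + banach +
  assumes ex_fundamental_decomposition: "\<exists>P M. fundamental_decomposition P M"

class complex_hilbert_space = complex_form_space + banach +
  assumes norm_eq_sqrt_ip: "norm x = sqrt (Re (ip x x))"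

definition bounded_clinear :: "('a::complex_normed_vector \<Rightarrow> 'b::complex_normed_vector) \<Rightarrow> bool" where
  "bounded_clinear f \<longleftrightarrow> bounded_linear f \<and> (\<forall>c x. f (c *\<^sub>C x) = c *\<^sub>C f x)"

definition adj :: "('a::complex_form_space \<Rightarrow> 'b::complex_form_space) \<Rightarrow> 'b \<Rightarrow> 'a" where
  "adj T = (THE S. \<forall>x y. ip (T x) y = ip x (S y))"

definition normal_op :: "('a::complex_form_space \<Rightarrow> 'a) \<Rightarrow> bool" where
  "normal_op N \<longleftrightarrow> bounded_clinear N \<and> N \<circ> adj N = adj N \<circ> N"

definition real_part :: "('a::complex_form_space \<Rightarrow> 'a) \<Rightarrow> 'a \<Rightarrow> 'a" where
  "real_part N = (\<lambda>x. (1/2) *\<^sub>C (N x + adj N x))"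

definition imag_part :: "('a::complex_form_space \<Rightarrow> 'a) \<Rightarrow> 'a \<Rightarrow> 'a" where
  "imag_part N = (\<lambda>x. (1 / (2 * \<i>)) *\<^sub>C (N x - adj N x))"

definition op_poly :: "real poly \<Rightarrow> ('a::real_vector \<Rightarrow> 'a) \<Rightarrow> 'a \<Rightarrow> 'a" where
  "op_poly p A = (\<lambda>x. \<Sum>i\<le>degree p. coeff p i *\<^sub>R (A ^^ i) x)"

definition nonneg_op :: "('a::complex_form_space \<Rightarrow> 'a) \<Rightarrow> bool" where
  "nonneg_op C \<longleftrightarrow> (\<forall>x. ip (C x) x \<in> \<real>\<^sub>\<ge>\<^sub>0)"

definition op_spectrum :: "('a::complex_normed_vector \<Rightarrow> 'a) \<Rightarrow> complex set" where
  "op_spectrum M = {z. \<not> (\<exists>S. bounded_clinear S \<and>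
     S \<circ> (\<lambda>x. M x - z *\<^sub>C x) = id \<and> (\<lambda>x. M x - z *\<^sub>C x) \<circ> S = id)}"

text \<open>
  \<open>Theta T C\<close> is meant for injective \<open>T\<close> and \<open>C\<close> commuting with \<open>T \<circ> adj T\<close>;
  then \<open>C\<close> maps the range of \<open>T\<close> into itself.
\<close>

definition Theta :: "('v \<Rightarrow> 'k) \<Rightarrow> ('k \<Rightarrow> 'k) \<Rightarrow> 'v \<Rightarrow> 'v" where
  "Theta T C = inv T \<circ> C \<circ> T"


section \<open>Function classes\<close>

abbreviation cpoly :: "real poly \<Rightarrow> complex poly" where
  "cpoly p \<equiv> map_poly complex_of_real p"

definition zero_mult :: "real poly \<Rightarrow> complex \<Rightarrow> nat" where
  "zero_mult p z = order z (cpoly p)"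

definition ZR :: "real poly \<Rightarrow> real poly \<Rightarrow> complex set" where
  "ZR p q = {Complex x y | x y. poly p x = 0 \<and> poly q y = 0}"

definition Zi :: "real poly \<Rightarrow> real poly \<Rightarrow> (complex \<times> complex) set" where
  "Zi p q = ({z. poly (cpoly p) z = 0} \<times> {w. poly (cpoly q) w = 0}) - \<real> \<times> \<real>"

text \<open>
  The points of the disjoint union \<open>(\<sigma> \<union> ZR) \<union> Zi\<close> are the elements of \<open>(\<sigma> \<union> ZR p q) <+> Zi p q\<close>.
  A family over a finite index set of pairs is a function vanishing off that index set, and
  \<open>\<complex>\<close> is identified with the families over \<open>{(0,0)}\<close>.
\<close>

type_synonym point = "complex + complex \<times> complex"
type_synonym family = "nat \<times> nat \<Rightarrow> complex"

definition I_A :: "nat \<Rightarrow> nat \<Rightarrow> (nat \<times> nat) set" where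
  "I_A m n = ({..<m} \<times> {..<n}) \<union> {(m, 0), (0, n)}"

definition I_B :: "nat \<Rightarrow> nat \<Rightarrow> (nat \<times> nat) set" where
  "I_B m n = {..<m} \<times> {..<n}"

definition families :: "(nat \<times> nat) set \<Rightarrow> family set" where
  "families I = {a. \<forall>i. i \<notin> I \<longrightarrow> a i = 0}"

definition restrict_family :: "(nat \<times> nat) set \<Rightarrow> family \<Rightarrow> family" where
  "restrict_family I a = (\<lambda>i. if i \<in> I then a i else 0)"

fun index_set :: "real poly \<Rightarrow> real poly \<Rightarrow> point \<Rightarrow> (nat \<times> nat) set" where
  "index_set p q (Inl z) =
     (if z \<in> ZR p q then I_A (zero_mult p (Re z)) (zero_mult q (Im z)) else {(0, 0)})"
| "index_set p q (Inr (\<xi>, \<eta>)) = I_B (zero_mult p \<xi>) (zero_mult q \<eta>)"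

text \<open>
  \<open>\<pi>\<close> at a point of \<open>ZR p q <+> Zi p q\<close>; on the \<open>Zi\<close> part it is the identity on \<open>families (index_set ..)\<close>.
\<close>

fun proj_family :: "real poly \<Rightarrow> real poly \<Rightarrow> point \<Rightarrow> family \<Rightarrow> family" where
  "proj_family p q (Inl z) a = restrict_family (I_B (zero_mult p (Re z)) (zero_mult q (Im z))) a"
| "proj_family p q (Inr (\<xi>, \<eta>)) a = restrict_family (I_B (zero_mult p \<xi>) (zero_mult q \<eta>)) a"

text \<open>The values of the functions off the domain \<open>(S \<union> ZR p q) <+> Zi p q\<close> are irrelevant.\<close>

definition M_fun :: "real poly \<Rightarrow> real poly \<Rightarrow> complex set \<Rightarrow> (point \<Rightarrow> family) set" where
  "M_fun p q S = (\<Pi> z \<in> (S \<union> ZR p q) <+> Zi p q. families (index_set p q z))"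

definition R_fun :: "real poly \<Rightarrow> real poly \<Rightarrow> complex set \<Rightarrow> (point \<Rightarrow> family) set" where
  "R_fun p q S =
     {\<phi> \<in> M_fun p q S. \<forall>z \<in> ZR p q <+> Zi p q. proj_family p q z (\<phi> z) = (\<lambda>_. 0)}"

definition quot :: "real poly \<Rightarrow> real poly \<Rightarrow> (point \<Rightarrow> family) \<Rightarrow> complex \<Rightarrow> complex \<Rightarrow> complex" where
  "quot p q \<phi> w z =
     (\<phi> (Inl z) (0, 0) -
        (\<Sum>k<zero_mult p (Re w). \<Sum>l<zero_mult q (Im w).
           \<phi> (Inl w) (k, l) * of_real (Re (z - w)) ^ k * of_real (Im (z - w)) ^ l)) /
     of_real (max (\<bar>Re (z - w)\<bar> ^ zero_mult p (Re w)) (\<bar>Im (z - w)\<bar> ^ zero_mult q (Im w)))"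

definition F_fun :: "real poly \<Rightarrow> real poly \<Rightarrow> complex set \<Rightarrow> (point \<Rightarrow> family) set" where
  "F_fun p q S =
     {\<phi> \<in> M_fun p q S.
        (\<lambda>z. \<phi> (Inl z) (0, 0)) \<in> borel_measurable (restrict_space borel (S - ZR p q)) \<and>
        bounded ((\<lambda>z. \<phi> (Inl z) (0, 0)) ` (S - ZR p q)) \<and>
        (\<forall>w \<in> S \<inter> ZR p q. \<exists>U. open U \<and> U \<inter> ZR p q = {w} \<and>
           bounded (quot p q \<phi> w ` (S \<inter> U - {w})))}"

text \<open>
  A polynomial in \<open>\<complex>[z,w]\<close> is a polynomial in \<open>w\<close> with coefficients in \<open>\<complex>[z]\<close>.
  \<open>taylor_coeff s k l \<xi> \<eta>\<close> is \<open>1/(k! l!)\<close> times the value at \<open>(\<xi>,\<eta>)\<close> of the \<open>k\<close>-th partial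
  derivative in \<open>z\<close> and \<open>l\<close>-th in \<open>w\<close>; at real \<open>(\<xi>,\<eta>)\<close> these are also the partial derivatives
  with respect to the real variables.
\<close>

definition poly_zw :: "complex poly poly \<Rightarrow> complex \<Rightarrow> complex \<Rightarrow> complex" where
  "poly_zw s z w = poly (poly s [:w:]) z"

definition taylor_coeff :: "complex poly poly \<Rightarrow> nat \<Rightarrow> nat \<Rightarrow> complex \<Rightarrow> complex \<Rightarrow> complex" where
  "taylor_coeff s k l \<xi> \<eta> =
     poly_zw ((map_poly pderiv ^^ k) ((pderiv ^^ l) s)) \<xi> \<eta> / (fact k * fact l)"

definition in_z :: "real poly \<Rightarrow> complex poly poly" where
  "in_z p = [:cpoly p:]"

definition in_w :: "real poly \<Rightarrow> complex poly poly" where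
  "in_w q = map_poly (\<lambda>c. [:complex_of_real c:]) q"

fun poly_fun :: "real poly \<Rightarrow> real poly \<Rightarrow> complex poly poly \<Rightarrow> point \<Rightarrow> family" where
  "poly_fun p q s (Inl z) =
     (if z \<in> ZR p q
      then restrict_family (index_set p q (Inl z)) (\<lambda>(k, l). taylor_coeff s k l (Re z) (Im z))
      else (\<lambda>i. if i = (0, 0) then poly_zw s (Re z) (Im z) else 0))"
| "poly_fun p q s (Inr (\<xi>, \<eta>)) =
     restrict_family (index_set p q (Inr (\<xi>, \<eta>))) (\<lambda>(k, l). taylor_coeff s k l \<xi> \<eta>)"

definition pq_fun :: "real poly \<Rightarrow> real poly \<Rightarrow> point \<Rightarrow> family" where
  "pq_fun p q z i = poly_fun p q (in_z p) z i + poly_fun p q (in_w q) z i"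

text \<open>
  The product of \<open>(p\<^sub>N + q\<^sub>N)(z)\<close> with \<open>c \<in> \<complex>\<close> (for \<open>z \<notin> ZR p q\<close>)
  or with \<open>(c\<^sub>1, c\<^sub>2) \<in> \<complex>\<^sup>2\<close> (for \<open>z \<in> ZR p q\<close>).
\<close>

fun pq_times :: "real poly \<Rightarrow> real poly \<Rightarrow> complex \<Rightarrow> complex + complex \<times> complex \<Rightarrow> family" where
  "pq_times p q z (Inl c) = (\<lambda>i. if i = (0, 0) then pq_fun p q (Inl z) (0, 0) * c else 0)"
| "pq_times p q z (Inr (c1, c2)) =
     (let m = zero_mult p (Re z); n = zero_mult q (Im z) in
      (\<lambda>i. if i = (m, 0) then pq_fun p q (Inl z) (m, 0) * c1
           else if i = (0, n) then pq_fun p q (Inl z) (0, n) * c2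
           else 0))"

end

theory Submission
  imports Defs
begin

text \<open>
  For \<open>s\<close> one takes a Hermite interpolation polynomial: at every pair of zeros of \<open>p\<close> and \<open>q\<close> its
  Taylor coefficients in the rectangle below the multiplicities are those prescribed by \<open>\<phi>\<close>
  (\<open>hermite_interpolation\<close>). Then \<open>\<phi> - s\<^sub>N\<close> is in \<open>R_fun p q \<sigma>\<close>, and \<open>g\<close> is forced: it is
  \<open>(\<phi>(z) - s(Re z, Im z)) / (p(Re z) + q(Im z))\<close> off \<open>ZR p q\<close>, and on \<open>ZR p q\<close> its two components
  solve scalar equations whose coefficients are the leading Taylor coefficients of \<open>p\<close> and \<open>q\<close>.

  What has to be proved is that the denominator has no zeros on \<open>\<sigma> - ZR p q\<close> and that \<open>g\<close> is
  bounded. Near a point \<open>w\<close> of \<open>ZR p q\<close> with multiplicities \<open>m\<close> and \<open>n\<close> the numerator is at most a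
  multiple of the larger of \<open>|Re (z - w)|^m\<close> and \<open>|Im (z - w)|^n\<close>, by the definition of \<open>F_fun\<close>
  and Taylor's formula. The summands \<open>p(Re z)\<close> and \<open>q(Im z)\<close> are of the size of one of these
  powers each, but their sum could be much smaller.

  This does not happen on the spectrum: for \<open>z \<in> \<sigma>\<close> both \<open>|p(Re z)|\<close> and \<open>|q(Im z)|\<close> are at most
  \<open>|p(Re z) + q(Im z)|\<close> (\<open>spectrum_Theta\<close>). Indeed \<open>Theta T N\<close> is normal on a Hilbert space, with
  real part \<open>a\<close> and imaginary part \<open>b\<close> say, and \<open>p(a) + q(b) = T* T\<close>. From \<open>T1 T1* = p(A)\<close> and
  \<open>[q(B) y, y] \<ge> 0\<close> one gets \<open>\<parallel>T1* y\<parallel> \<le> \<parallel>T* y\<parallel>\<close>, which leads to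
  \<open>\<parallel>p(a) x\<parallel> \<le> \<parallel>T* T x\<parallel> = \<parallel>p(a) x + q(b) x\<parallel>\<close> (\<open>norm_le_of_nonneg_summand\<close>); with \<open>T2\<close> in place of
  \<open>T1\<close> the same holds for \<open>q(b)\<close>. Evaluation at approximate eigenvectors of \<open>Theta T N\<close> for \<open>z\<close>
  gives the inequalities for numbers.

  The operator theory behind this is built up from one Riesz representation theorem. It yields
  adjoints in Krein spaces, density of the range of \<open>T*\<close>, and invertibility of normal operators
  that are bounded below, so that spectral points have approximate eigenvectors and \<open>\<sigma>\<close> is
  compact. That \<open>Theta T N\<close> is a bounded operator rests on an inequality of Lax (\<open>Lax_bound\<close>).
\<close>

section \<open>Hermitian forms and the Riesz representation theorem\<close>

lemma csubspaceD:
  assumes "csubspace H"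
  shows "0 \<in> H" "\<And>x y. x \<in> H \<Longrightarrow> y \<in> H \<Longrightarrow> x + y \<in> H" "\<And>c x. x \<in> H \<Longrightarrow> c *\<^sub>C x \<in> H"
  using assms unfolding csubspace_def by auto

lemma scaleC_zero_right [simp]: "c *\<^sub>C (0::'a::complex_vector) = 0"
  using scaleC_add_right[of c 0 0] by simp

lemma scaleC_minus_one: "(- 1) *\<^sub>C x = - (x::'a::complex_vector)"
  using scaleR_scaleC[of "-1" x] by simp

lemma scaleC_minus_left: "(- c) *\<^sub>C x = - (c *\<^sub>C (x::'a::complex_vector))"
  using scaleC_scaleC[of "-1" c x] by (simp add: scaleC_minus_one)

lemma scaleC_diff_left: "(a - b) *\<^sub>C x = a *\<^sub>C x - b *\<^sub>C (x::'a::complex_vector)"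
  using scaleC_add_left[of a "-b" x] by (simp add: scaleC_minus_left)

lemma scaleC_diff_right: "c *\<^sub>C (x - y) = c *\<^sub>C x - c *\<^sub>C (y::'a::complex_vector)"
  using scaleC_add_right[of c "x - y" y] by (simp add: algebra_simps)

lemma csubspace_diff: "csubspace H \<Longrightarrow> x \<in> H \<Longrightarrow> y \<in> H \<Longrightarrow> x - y \<in> H"
  for H :: "'a::complex_vector set"
  using csubspaceD(2)[of H x "- y"] csubspaceD(3)[of H y "-1"] by (simp add: scaleC_minus_one)

text \<open>
  One Riesz theorem serves three situations: both halves of a fundamental decomposition, closed
  subspaces of a Hilbert space, and the form \<open>[E x, E y]\<close> of an operator \<open>E\<close> that is bounded
  below. So the forms are not tied to \<open>ip\<close>, and they need only be definite on a subspace \<open>H\<close>.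
\<close>

locale hermitian_form =
  fixes f :: "'a::complex_vector \<Rightarrow> 'a \<Rightarrow> complex"
  assumes add_left: "f (x + y) z = f x z + f y z"
    and scaleC_left: "f (a *\<^sub>C x) y = a * f x y"
    and commute: "f x y = cnj (f y x)"
begin

lemma add_right: "f x (y + z) = f x y + f x z"
  using add_left[of y z x] commute[of x] by (metis complex_cnj_add)

lemma scaleC_right: "f x (a *\<^sub>C y) = cnj a * f x y"
  by (metis scaleC_left commute complex_cnj_mult)

lemma zero_left: "f 0 y = 0"
  using scaleC_left[of 0 0 y] by simp

lemma zero_right: "f x 0 = 0"
  using scaleC_right[of x 0 0] by simp

lemma minus_left: "f (- x) y = - f x y"
  using scaleC_left[of "-1" x y] by (simp add: scaleC_minus_one)

lemma minus_right: "f x (- y) = - f x y"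
  using scaleC_right[of x "-1" y] by (simp add: scaleC_minus_one)

lemma diff_left: "f (x - y) z = f x z - f y z"
  using add_left[of x "- y" z] by (simp add: minus_left)

lemma diff_right: "f x (y - z) = f x y - f x z"
  using add_right[of x y "- z"] by (simp add: minus_right)

lemma scaleR_left: "f (r *\<^sub>R x) y = of_real r * f x y"
  by (simp add: scaleR_scaleC scaleC_left)

lemma scaleR_right: "f x (r *\<^sub>R y) = of_real r * f x y"
  by (simp add: scaleR_scaleC scaleC_right)

lemmas form_simps = add_left add_right diff_left diff_right minus_left minus_right
  scaleC_left scaleC_right scaleR_left scaleR_right zero_left zero_right

lemma Re_commute: "Re (f y x) = Re (f x y)"
  using commute[of x y] by simp

lemma Im_self: "Im (f x x) = 0"
  using commute[of x x] by (metis cnj.simps(2) equation_minus_iff neg_equal_zero)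

lemma hilbert_on_Re_nonneg: "hilbert_on f H \<Longrightarrow> x \<in> H \<Longrightarrow> 0 \<le> Re (f x x)"
  unfolding hilbert_on_def by (cases "x = 0") (auto simp: zero_left less_imp_le)

lemma Cauchy_Schwarz:
  assumes "hilbert_on f H" "x \<in> H" "y \<in> H"
  shows "(cmod (f x y))\<^sup>2 \<le> Re (f x x) * Re (f y y)"
proof (cases "y = 0")
  case True
  then show ?thesis by (simp add: zero_right)
next
  case False
  define Y where "Y = Re (f y y)"
  have Y: "Y > 0" using assms False unfolding hilbert_on_def Y_def by auto
  have fyy: "f y y = of_real Y" by (simp add: Y_def complex_eq_iff Im_self)
  define c where "c = f x y / of_real Y"
  have "x - c *\<^sub>C y \<in> H"
    using assms csubspace_diff csubspaceD(3) unfolding hilbert_on_def by blast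
  then have "0 \<le> Re (f (x - c *\<^sub>C y) (x - c *\<^sub>C y))"
    using hilbert_on_Re_nonneg assms by blast
  also have "f (x - c *\<^sub>C y) (x - c *\<^sub>C y)
      = f x x - cnj c * f x y - c * cnj (f x y) + cnj c * (c * of_real Y)"
    by (simp add: form_simps fyy commute[of y x] algebra_simps)
  also have "c * of_real Y = f x y" using Y by (simp add: c_def)
  also have "c * cnj (f x y) = of_real ((cmod (f x y))\<^sup>2 / Y)"
    by (simp add: c_def complex_norm_square[symmetric])
  finally have "(cmod (f x y))\<^sup>2 / Y \<le> Re (f x x)" by simp
  then show ?thesis using Y by (simp add: Y_def field_simps)
qed

lemma Cauchy_Schwarz_sqrt:
  assumes "hilbert_on f H" "x \<in> H" "y \<in> H"
  shows "cmod (f x y) \<le> sqrt (Re (f x x)) * sqrt (Re (f y y))"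
  using Cauchy_Schwarz[OF assms] by (metis real_le_rsqrt real_sqrt_mult)

text \<open>
  The representing vector minimises \<open>F x = [x, x] - 2 Re (l x)\<close> on \<open>H\<close>. The parallelogram law
  makes every minimising sequence Cauchy, completeness yields a minimiser \<open>a\<close>, and the vanishing
  of the first variation of \<open>F\<close> at \<open>a\<close> is the claimed identity.
\<close>

lemma Riesz_representation:
  assumes H: "hilbert_on f H"
    and l_add: "\<And>x y. x \<in> H \<Longrightarrow> y \<in> H \<Longrightarrow> l (x + y) = l x + l y"
    and l_scale: "\<And>a x. x \<in> H \<Longrightarrow> l (a *\<^sub>C x) = a * l x"
    and l_bound: "\<And>x. x \<in> H \<Longrightarrow> (cmod (l x))\<^sup>2 \<le> C * Re (f x x)"
  shows "\<exists>a\<in>H. \<forall>x\<in>H. l x = f x a"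
proof -
  have sub: "csubspace H" using H unfolding hilbert_on_def by auto
  note subs = csubspaceD[OF sub] csubspace_diff[OF sub]
  have real_scale: "r *\<^sub>R x \<in> H" if "x \<in> H" for r x
    using subs(3)[OF that, of "of_real r"] by (simp add: scaleR_scaleC)
  have l_real: "l (r *\<^sub>R x) = of_real r * l x" if "x \<in> H" for r x
    using l_scale[OF that, of "of_real r"] by (simp add: scaleR_scaleC)
  have l_diff: "l (x - y) = l x - l y" if "x \<in> H" "y \<in> H" for x y
    using l_add[OF subs(4)[OF that] that(2)] by simp
  have nonneg: "0 \<le> Re (f x x)" if "x \<in> H" for x using hilbert_on_Re_nonneg[OF H that] .
  define F where "F = (\<lambda>x. Re (f x x) - 2 * Re (l x))"
  have bdd: "- \<bar>C\<bar> \<le> F x" if x: "x \<in> H" for x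
  proof -
    let ?r = "sqrt (Re (f x x))"
    have "(cmod (l x))\<^sup>2 \<le> \<bar>C\<bar> * Re (f x x)"
      using l_bound[OF x] nonneg[OF x] by (smt (verit) mult_right_mono)
    then have "cmod (l x) \<le> sqrt \<bar>C\<bar> * ?r" by (metis real_le_rsqrt real_sqrt_mult)
    then have "Re (l x) \<le> sqrt \<bar>C\<bar> * ?r" using complex_Re_le_cmod order_trans by blast
    moreover have "0 \<le> (sqrt \<bar>C\<bar> - ?r)\<^sup>2" by simp
    then have "0 \<le> \<bar>C\<bar> - 2 * (sqrt \<bar>C\<bar> * ?r) + Re (f x x)"
      using nonneg[OF x] by (simp add: power2_diff)
    ultimately show ?thesis unfolding F_def by linarith
  qed
  define I where "I = Inf (F ` H)"
  have bb: "bdd_below (F ` H)" using bdd by (auto simp: bdd_below_def)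
  have I_le: "I \<le> F x" if "x \<in> H" for x
    unfolding I_def using bb that by (intro cInf_lower) auto
  have "\<exists>x\<in>H. F x < I + 1 / real (Suc n)" for n
  proof -
    have "F ` H \<noteq> {}" using subs(1) by auto
    then have "\<exists>y\<in>F ` H. y < I + 1 / real (Suc n)"
      unfolding I_def by (intro cInf_lessD) auto
    then show ?thesis by auto
  qed
  then obtain X where XH: "\<And>n. X n \<in> H" and XF: "\<And>n. F (X n) < I + 1 / real (Suc n)"
    by metis
  \<comment> \<open>The parallelogram law: the midpoint of \<open>x\<close> and \<open>y\<close> cannot lie below the infimum.\<close>
  have para: "Re (f (x - y) (x - y)) \<le> 2 * F x + 2 * F y - 4 * I" if "x \<in> H" "y \<in> H" for x y
  proof -
    have m: "(1/2) *\<^sub>R (x + y) \<in> H" using that subs real_scale by auto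
    have "Re (l ((1/2) *\<^sub>R (x + y))) = (Re (l x) + Re (l y)) / 2"
      unfolding l_real[OF subs(2)[OF that]] l_add[OF that] times_complex.sel by simp
    then have "4 * F ((1/2) *\<^sub>R (x + y)) = 2 * F x + 2 * F y - Re (f (x - y) (x - y))"
      unfolding F_def using Re_commute[of x y] by (simp add: form_simps field_simps)
    then show ?thesis using I_le[OF m] by linarith
  qed
  have cau: "\<forall>e>0. \<exists>n0. \<forall>m\<ge>n0. \<forall>n\<ge>n0. Re (f (X m - X n) (X m - X n)) < e"
  proof (intro allI impI)
    fix e :: real assume "e > 0"
    then obtain n0 where n0: "1 / real (Suc n0) < e / 4"
      using nat_approx_posE[of "e/4"] by auto
    have near: "F (X n) - I < e / 4" if "n \<ge> n0" for n
    proof -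
      have "1 / real (Suc n) \<le> 1 / real (Suc n0)" using that by (simp add: frac_le)
      then show ?thesis using XF[of n] n0 by linarith
    qed
    then show "\<exists>n0. \<forall>m\<ge>n0. \<forall>n\<ge>n0. Re (f (X m - X n) (X m - X n)) < e"
    proof (intro exI[of _ n0] allI impI)
      fix m n assume "n0 \<le> m" "n0 \<le> n"
      then have "F (X m) - I < e / 4" "F (X n) - I < e / 4" using near by blast+
      then show "Re (f (X m - X n) (X m - X n)) < e" using para[OF XH XH, of m n] by linarith
    qed
  qed
  from H have "\<forall>X. (\<forall>n::nat. X n \<in> H) \<and>
          (\<forall>e>0. \<exists>n0. \<forall>m\<ge>n0. \<forall>n\<ge>n0. Re (f (X m - X n) (X m - X n)) < e) \<longrightarrow>
          (\<exists>x\<in>H. (\<lambda>n. Re (f (X n - x) (X n - x))) \<longlonglongrightarrow> 0)"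
    unfolding hilbert_on_def by blast
  then obtain a where a: "a \<in> H" and lim: "(\<lambda>n. Re (f (X n - a) (X n - a))) \<longlonglongrightarrow> 0"
    using XH cau by blast
  let ?d = "\<lambda>n. X n - a"
  have dH: "?d n \<in> H" for n using subs(4)[OF XH a] .
  have sq: "(\<lambda>n. sqrt (Re (f (?d n) (?d n)))) \<longlonglongrightarrow> 0"
    using tendsto_real_sqrt[OF lim] by simp
  have lim_f: "(\<lambda>n. f (?d n) a) \<longlonglongrightarrow> 0"
    by (rule Lim_null_comparison[OF always_eventually tendsto_mult_left_zero[OF sq]])
       (use Cauchy_Schwarz_sqrt[OF H dH a] in auto)
  have lim_l: "(\<lambda>n. l (?d n)) \<longlonglongrightarrow> 0"
  proof (rule Lim_null_comparison[OF always_eventually tendsto_mult_right_zero[OF sq]])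
    show "\<forall>n. cmod (l (?d n)) \<le> sqrt C * sqrt (Re (f (?d n) (?d n)))"
      using l_bound[OF dH] by (metis real_le_rsqrt real_sqrt_mult)
  qed
  have "F (X n) = F a + Re (f (?d n) (?d n)) + 2 * Re (f (?d n) a) - 2 * Re (l (?d n))" for n
    unfolding F_def using Re_commute[of a "X n"] by (simp add: form_simps l_diff[OF XH a])
  then have "(\<lambda>n. F (X n)) \<longlonglongrightarrow> F a + 0 + 2 * Re 0 - 2 * Re 0"
    by (simp only:) (intro tendsto_intros lim lim_f lim_l)
  moreover have "(\<lambda>n. I + 1 / real (Suc n)) \<longlonglongrightarrow> I + 0"
    by (intro tendsto_intros LIMSEQ_Suc lim_1_over_n)
  ultimately have Fa: "F a \<le> I"
    using LIMSEQ_le[of "\<lambda>n. F (X n)" _ "\<lambda>n. I + 1 / real (Suc n)"] XF by (force intro: less_imp_le)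
  have stat: "Re (l h) = Re (f h a)" if h: "h \<in> H" for h
  proof -
    define b where "b = Re (f h a) - Re (l h)"
    define Q where "Q = Re (f h h)"
    have Q: "Q \<ge> 0" using nonneg[OF h] by (simp add: Q_def)
    \<comment> \<open>The variation of \<open>F\<close> at \<open>a\<close> in the real direction \<open>h\<close> is a quadratic polynomial in \<open>t\<close>.\<close>
    have ineq: "0 \<le> t * t * Q + 2 * t * b" for t
    proof -
      have "F a \<le> F (a + t *\<^sub>R h)" 
        using Fa I_le[OF subs(2)[OF a real_scale[OF h]]] by (rule order_trans)
      then show ?thesis
        unfolding F_def b_def Q_def using Re_commute[of a h] l_add[OF a real_scale[OF h]] l_real[OF h]
        by (simp add: form_simps algebra_simps)
    qed
    have "b = 0"
    proof (cases "Q = 0")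
      case True
      then show ?thesis using ineq[of 1] ineq[of "-1"] by simp
    next
      case False
      then have "Q > 0" using Q by simp
      have "0 \<le> (- b / Q) * (- b / Q) * Q + 2 * (- b / Q) * b" by (rule ineq)
      also have "\<dots> = - (b * b) / Q" using \<open>Q > 0\<close> by (simp add: field_simps)
      finally have "b * b \<le> 0" using \<open>Q > 0\<close> by (simp add: divide_le_0_iff zero_le_divide_iff)
      then show ?thesis by (auto simp: mult_le_0_iff)
    qed
    then show ?thesis by (simp add: b_def)
  qed
  \<comment> \<open>The direction \<open>\<i> h\<close> supplies the imaginary part.\<close>
  have "l h = f h a" if h: "h \<in> H" for h
    using stat[OF h] stat[OF subs(3)[OF h, of \<i>]] by (simp add: l_scale[OF h] scaleC_left complex_eq_iff)
  then show ?thesis using a by blast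
qed

end

lemma hermitian_form_ip: "hermitian_form (ip :: 'a::complex_form_space \<Rightarrow> 'a \<Rightarrow> complex)"
  by unfold_locales (rule ip_add_left ip_scaleC_left ip_commute)+

interpretation ip: hermitian_form "ip :: 'a::complex_form_space \<Rightarrow> 'a \<Rightarrow> complex"
  by (rule hermitian_form_ip)

lemma Re_ip_self: "Re (ip x x) = (norm x)\<^sup>2" for x :: "'a::complex_hilbert_space"
proof -
  have "0 \<le> sqrt (Re (ip x x))" unfolding norm_eq_sqrt_ip[symmetric] by simp
  then show ?thesis unfolding norm_eq_sqrt_ip[of x] by simp
qed

lemma Cauchy_of_norm_sq_diff:
  fixes X :: "nat \<Rightarrow> 'a::real_normed_vector"
  assumes "\<forall>e>0. \<exists>n0. \<forall>m\<ge>n0. \<forall>n\<ge>n0. (norm (X m - X n))\<^sup>2 < e"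
  shows "Cauchy X"
  unfolding Cauchy_def dist_norm
proof (intro allI impI)
  fix e :: real assume "e > 0"
  then obtain n0 where "\<forall>m\<ge>n0. \<forall>n\<ge>n0. (norm (X m - X n))\<^sup>2 < e\<^sup>2"
    using assms by (meson zero_less_power)
  then show "\<exists>M. \<forall>m\<ge>M. \<forall>n\<ge>M. norm (X m - X n) < e"
    using \<open>e > 0\<close> by (meson less_imp_le power2_less_imp_less)
qed

text \<open>
  With the decomposition into the whole space and \<open>{0}\<close>, every result on Krein spaces below also
  holds for Hilbert spaces; in particular adjoints of operators between spaces of the two kinds
  need no separate treatment.
\<close>

instance complex_hilbert_space \<subseteq> krein_space
proof
  have lims: "\<exists>x. (\<lambda>n. norm (X n - x)) \<longlonglongrightarrow> 0"
    if c: "\<forall>e>0. \<exists>n0. \<forall>m\<ge>n0. \<forall>n\<ge>n0. (norm (X m - X n))\<^sup>2 < e" for X :: "nat \<Rightarrow> 'a"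
  proof -
    have "Cauchy X" using c by (rule Cauchy_of_norm_sq_diff)
    then obtain L where "X \<longlonglongrightarrow> L" using Cauchy_convergent convergent_def by blast
    then have "(\<lambda>n. norm (X n - L)) \<longlonglongrightarrow> norm (L - L)" by (intro tendsto_intros)
    then show ?thesis by auto
  qed
  show "\<exists>P M. fundamental_decomposition P (M :: 'a set)"
    unfolding fundamental_decomposition_def hilbert_on_def csubspace_def
    by (rule exI[of _ UNIV], rule exI[of _ "{0}"])
       (auto simp: Re_ip_self ip.zero_left ip.zero_right lims intro!: exI[of _ 1])
qed

section \<open>Adjoints in Krein spaces\<close>

lemma krein_decomposition:
  obtains P M :: "'a::krein_space set" and c C
  where "hilbert_on ip P" "hilbert_on (\<lambda>x y. - ip x y) M"
    "\<And>x. \<exists>u\<in>P. \<exists>v\<in>M. x = u + v" "\<And>u v. u \<in> P \<Longrightarrow> v \<in> M \<Longrightarrow> ip u v = 0"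
    "\<And>u v. u \<in> P \<Longrightarrow> v \<in> M \<Longrightarrow> ip v u = 0" "0 < c" "0 < C"
    "\<And>u v. u \<in> P \<Longrightarrow> v \<in> M \<Longrightarrow> c * (norm (u + v))\<^sup>2 \<le> Re (ip u u) - Re (ip v v)"
    "\<And>u v. u \<in> P \<Longrightarrow> v \<in> M \<Longrightarrow> Re (ip u u) - Re (ip v v) \<le> C * (norm (u + v))\<^sup>2"
proof -
  obtain P M :: "'a set" where d: "fundamental_decomposition P M"
    using ex_fundamental_decomposition by blast
  note d' = d[unfolded fundamental_decomposition_def]
  obtain c C where cC: "0 < c" "0 < C"
    "\<And>u v. u \<in> P \<Longrightarrow> v \<in> M \<Longrightarrow> c * (norm (u + v))\<^sup>2 \<le> Re (ip u u) - Re (ip v v)"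
    "\<And>u v. u \<in> P \<Longrightarrow> v \<in> M \<Longrightarrow> Re (ip u u) - Re (ip v v) \<le> C * (norm (u + v))\<^sup>2"
    using d' by (elim conjE exE) metis
  have orth: "ip u v = 0" "ip v u = 0" if "u \<in> P" "v \<in> M" for u v
  proof -
    show "ip u v = 0" using d' that by (elim conjE) metis
    then show "ip v u = 0" by (subst ip_commute) simp
  qed
  show thesis
  proof (rule that[OF _ _ _ orth cC])
    show "hilbert_on ip P" "hilbert_on (\<lambda>x y. - ip x y) M"
      using d' by blast+
    show "\<exists>u\<in>P. \<exists>v\<in>M. x = u + v" for x using d' by (elim conjE) metis
  qed
qed

lemma hermitian_form_minus:
  assumes "hermitian_form f"
  shows "hermitian_form (\<lambda>x y. - f x y)"
proof -
  interpret hermitian_form f by fact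
  show ?thesis by unfold_locales (simp_all add: form_simps commute[symmetric])
qed

lemma sqrt_le_sqrt_mult: "r \<le> C * a\<^sup>2 \<Longrightarrow> 0 \<le> a \<Longrightarrow> sqrt r \<le> sqrt C * a"
  using real_sqrt_le_mono[of r "C * a\<^sup>2"] by (simp add: real_sqrt_mult)

text \<open>
  By orthogonality the form splits into its two definite parts, to each of which the
  Cauchy-Schwarz inequality applies.
\<close>

lemma ip_bounded:
  obtains C where "C > 0" "\<And>x y :: 'a::krein_space. cmod (ip x y) \<le> C * norm x * norm y"
proof -
  obtain P M :: "'a set" and c C where P: "hilbert_on ip P" and M: "hilbert_on (\<lambda>x y. - ip x y) M"
    and split: "\<And>x. \<exists>u\<in>P. \<exists>v\<in>M. x = u + v"
    and orth: "\<And>u v. u \<in> P \<Longrightarrow> v \<in> M \<Longrightarrow> ip u v = 0" "\<And>u v. u \<in> P \<Longrightarrow> v \<in> M \<Longrightarrow> ip v u = 0"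
    and c: "0 < c" and C: "0 < C"
    and ge: "\<And>u v. u \<in> P \<Longrightarrow> v \<in> M \<Longrightarrow> c * (norm (u + v))\<^sup>2 \<le> Re (ip u u) - Re (ip v v)"
    and le: "\<And>u v. u \<in> P \<Longrightarrow> v \<in> M \<Longrightarrow> Re (ip u u) - Re (ip v v) \<le> C * (norm (u + v))\<^sup>2"
    by (rule krein_decomposition) (rule that)
  interpret m: hermitian_form "\<lambda>x y :: 'a. - ip x y"
    by (rule hermitian_form_minus) (rule hermitian_form_ip)
  have part: "sqrt (Re (ip u u)) \<le> sqrt C * norm (u + v)" "sqrt (- Re (ip v v)) \<le> sqrt C * norm (u + v)"
    if "u \<in> P" "v \<in> M" for u v
  proof -
    have "Re (ip u u) \<le> C * (norm (u + v))\<^sup>2" "- Re (ip v v) \<le> C * (norm (u + v))\<^sup>2"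
      using le[OF that] ip.hilbert_on_Re_nonneg[OF P that(1)] m.hilbert_on_Re_nonneg[OF M that(2)] by auto
    then show "sqrt (Re (ip u u)) \<le> sqrt C * norm (u + v)" "sqrt (- Re (ip v v)) \<le> sqrt C * norm (u + v)"
      using sqrt_le_sqrt_mult[OF _ norm_ge_zero] by blast+
  qed
  have "cmod (ip x y) \<le> (2 * C) * norm x * norm y" for x y :: 'a
  proof -
    obtain u v where uv: "u \<in> P" "v \<in> M" "x = u + v" using split by blast
    obtain u' v' where uv': "u' \<in> P" "v' \<in> M" "y = u' + v'" using split by blast
    have "cmod (ip u u') \<le> (sqrt C * norm x) * (sqrt C * norm y)"
    proof -
      have "cmod (ip u u') \<le> sqrt (Re (ip u u)) * sqrt (Re (ip u' u'))"
        by (rule ip.Cauchy_Schwarz_sqrt[OF P uv(1) uv'(1)])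
      also have "\<dots> \<le> (sqrt C * norm x) * (sqrt C * norm y)"
        using part(1)[OF uv(1,2)] part(1)[OF uv'(1,2)] ip.hilbert_on_Re_nonneg[OF P uv(1)]
          ip.hilbert_on_Re_nonneg[OF P uv'(1)] C
        unfolding uv(3) uv'(3) by (intro mult_mono) auto
      finally show ?thesis .
    qed
    moreover have "cmod (ip v v') \<le> (sqrt C * norm x) * (sqrt C * norm y)"
    proof -
      have "cmod (ip v v') \<le> sqrt (- Re (ip v v)) * sqrt (- Re (ip v' v'))"
        using m.Cauchy_Schwarz_sqrt[OF M uv(2) uv'(2)] by simp
      also have "\<dots> \<le> (sqrt C * norm x) * (sqrt C * norm y)"
        using part(2)[OF uv(1,2)] part(2)[OF uv'(1,2)] m.hilbert_on_Re_nonneg[OF M uv(2)]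
          m.hilbert_on_Re_nonneg[OF M uv'(2)] C
        unfolding uv(3) uv'(3) by (intro mult_mono) auto
      finally show ?thesis .
    qed
    moreover have "ip x y = ip u u' + ip v v'"
      using uv uv' orth by (simp add: ip.form_simps)
    moreover have "(sqrt C * norm x) * (sqrt C * norm y) = (sqrt C * sqrt C) * norm x * norm y"
      by (simp only: mult_ac)
    moreover have "sqrt C * sqrt C = C" using C by simp
    ultimately show ?thesis using norm_triangle_ineq[of "ip u u'" "ip v v'"] by simp
  qed
  then show thesis using that[of "2 * C"] C by simp
qed

text \<open>
  The indefinite form still controls the norm by duality: for \<open>x = u + v\<close> the test vector \<open>u - v\<close>
  turns \<open>[x, u - v]\<close> into the definite expression \<open>[u, u] - [v, v]\<close>.
\<close>

lemma norm_le_of_ip_le: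
  obtains K where "K > 0"
    "\<And>(x::'a::krein_space) B. 0 \<le> B \<Longrightarrow> (\<And>y. cmod (ip x y) \<le> B * norm y) \<Longrightarrow> norm x \<le> K * B"
proof -
  obtain P M :: "'a set" and c C where P: "hilbert_on ip P" and M: "hilbert_on (\<lambda>x y. - ip x y) M"
    and split: "\<And>x. \<exists>u\<in>P. \<exists>v\<in>M. x = u + v"
    and orth: "\<And>u v. u \<in> P \<Longrightarrow> v \<in> M \<Longrightarrow> ip u v = 0" "\<And>u v. u \<in> P \<Longrightarrow> v \<in> M \<Longrightarrow> ip v u = 0"
    and c: "0 < c" and C: "0 < C"
    and ge: "\<And>u v. u \<in> P \<Longrightarrow> v \<in> M \<Longrightarrow> c * (norm (u + v))\<^sup>2 \<le> Re (ip u u) - Re (ip v v)"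
    and le: "\<And>u v. u \<in> P \<Longrightarrow> v \<in> M \<Longrightarrow> Re (ip u u) - Re (ip v v) \<le> C * (norm (u + v))\<^sup>2"
    by (rule krein_decomposition) (rule that)
  define K where "K = sqrt (C / c)"
  have K: "K > 0" using c C by (simp add: K_def)
  have "norm x \<le> (K / c) * B" if B: "0 \<le> B" and b: "\<And>y. cmod (ip x y) \<le> B * norm y" for x :: 'a and B
  proof (cases "x = 0")
    case True
    then show ?thesis using B c K by simp
  next
    case False
    obtain u v where uv: "u \<in> P" "v \<in> M" "x = u + v" using split by blast
    have mv: "- v \<in> M"
      using M uv(2) csubspaceD(3)[of M v "-1"] unfolding hilbert_on_def by (simp add: scaleC_minus_one)
    have "c * (norm (u - v))\<^sup>2 \<le> Re (ip u u) - Re (ip v v)"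
      using ge[OF uv(1) mv] by (simp add: ip.form_simps)
    also have "\<dots> \<le> C * (norm x)\<^sup>2" using le[OF uv(1,2)] uv(3) by simp
    finally have "(norm (u - v))\<^sup>2 \<le> (C / c) * (norm x)\<^sup>2" using c by (simp add: field_simps)
    from sqrt_le_sqrt_mult[OF this norm_ge_zero]
    have *: "norm (u - v) \<le> K * norm x" unfolding K_def real_sqrt_abs abs_norm_cancel .
    have "c * (norm x)\<^sup>2 \<le> Re (ip u u) - Re (ip v v)" using ge[OF uv(1,2)] uv(3) by simp
    also have "\<dots> = Re (ip x (u - v))" using uv orth by (simp add: ip.form_simps)
    also have "\<dots> \<le> cmod (ip x (u - v))" by (rule complex_Re_le_cmod)
    also have "\<dots> \<le> B * norm (u - v)" by (rule b)
    also have "\<dots> \<le> B * (K * norm x)" using * B by (rule mult_left_mono)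
    finally have "(c * norm x) * norm x \<le> (B * K) * norm x" by (simp add: power2_eq_square mult.assoc)
    then have "c * norm x \<le> B * K" by (rule mult_right_le_imp_le) (use False in simp)
    then show ?thesis using c by (simp add: field_simps)
  qed
  then show thesis using that[of "K / c"] c K by simp
qed

lemma ip_nondegenerate:
  assumes "\<And>x. ip x a = ip x (b::'a::krein_space)"
  shows "a = b"
proof -
  obtain K where K: "\<And>(x::'a) B. 0 \<le> B \<Longrightarrow> (\<And>y. cmod (ip x y) \<le> B * norm y) \<Longrightarrow> norm x \<le> K * B"
    using norm_le_of_ip_le by metis
  have "ip (a - b) y = 0" for y
    using assms[of y] ip_commute[of "a - b" y] by (simp add: ip.form_simps)
  then have "norm (a - b) \<le> K * 0" by (intro K) auto
  then show ?thesis by simp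
qed

text \<open>
  Representing vectors \<open>a\<close> for the positive part and \<open>b\<close> for the negative part (with respect to
  the form \<open>- ip\<close>) combine to \<open>a - b\<close>.
\<close>

lemma Riesz_representation_krein:
  fixes l :: "'a::krein_space \<Rightarrow> complex"
  assumes add: "\<And>x y. l (x + y) = l x + l y"
    and scale: "\<And>a x. l (a *\<^sub>C x) = a * l x"
    and bound: "\<And>x. cmod (l x) \<le> B * norm x"
  shows "\<exists>a. \<forall>x. l x = ip x a"
proof -
  obtain P M :: "'a set" and c C where P: "hilbert_on ip P" and M: "hilbert_on (\<lambda>x y. - ip x y) M"
    and split: "\<And>x. \<exists>u\<in>P. \<exists>v\<in>M. x = u + v"
    and orth: "\<And>u v. u \<in> P \<Longrightarrow> v \<in> M \<Longrightarrow> ip u v = 0" "\<And>u v. u \<in> P \<Longrightarrow> v \<in> M \<Longrightarrow> ip v u = 0"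
    and c: "0 < c" and C: "0 < C"
    and ge: "\<And>u v. u \<in> P \<Longrightarrow> v \<in> M \<Longrightarrow> c * (norm (u + v))\<^sup>2 \<le> Re (ip u u) - Re (ip v v)"
    and le: "\<And>u v. u \<in> P \<Longrightarrow> v \<in> M \<Longrightarrow> Re (ip u u) - Re (ip v v) \<le> C * (norm (u + v))\<^sup>2"
    by (rule krein_decomposition) (rule that)
  interpret m: hermitian_form "\<lambda>x y :: 'a. - ip x y"
    by (rule hermitian_form_minus) (rule hermitian_form_ip)
  have zero: "0 \<in> P" "0 \<in> M" using P M unfolding hilbert_on_def csubspace_def by auto
  have sq: "(cmod (l x))\<^sup>2 \<le> B\<^sup>2 / c * r" if "c * (norm x)\<^sup>2 \<le> r" for x r
  proof -
    have "(cmod (l x))\<^sup>2 \<le> (B * norm x)\<^sup>2" by (intro power_mono bound) simp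
    also have "\<dots> = B\<^sup>2 / c * (c * (norm x)\<^sup>2)" using c by (simp add: power_mult_distrib)
    also have "\<dots> \<le> B\<^sup>2 / c * r" using that c by (intro mult_left_mono) auto
    finally show ?thesis .
  qed
  have "\<exists>a\<in>P. \<forall>x\<in>P. l x = ip x a"
    using ge[OF _ zero(2)]
    by (intro ip.Riesz_representation[OF P, of _ "B\<^sup>2 / c"] add scale sq) (simp add: ip.zero_left)
  then obtain a where a: "a \<in> P" "\<And>x. x \<in> P \<Longrightarrow> l x = ip x a" by blast
  have "\<exists>a\<in>M. \<forall>x\<in>M. l x = - ip x a"
    using ge[OF zero(1)]
    by (intro m.Riesz_representation[OF M, of _ "B\<^sup>2 / c"] add scale sq) (simp add: ip.zero_left)
  then obtain b where b: "b \<in> M" "\<And>x. x \<in> M \<Longrightarrow> l x = - ip x b" by blast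
  have "l x = ip x (a - b)" for x
  proof -
    obtain u v where uv: "u \<in> P" "v \<in> M" "x = u + v" using split by blast
    then show ?thesis using a b orth by (simp add: add ip.form_simps)
  qed
  then show ?thesis by blast
qed

lemma bounded_clinearI:
  fixes f :: "'a::complex_normed_vector \<Rightarrow> 'b::complex_normed_vector"
  assumes add: "\<And>x y. f (x + y) = f x + f y"
    and scale: "\<And>c x. f (c *\<^sub>C x) = c *\<^sub>C f x"
    and bound: "\<And>x. norm (f x) \<le> K * norm x"
  shows "bounded_clinear f"
  unfolding bounded_clinear_def
  using assms by (auto intro!: bounded_linear_intro[of f K] simp: scaleR_scaleC mult.commute)

lemma bounded_clinearD:
  assumes "bounded_clinear f"
  shows "bounded_linear f" "\<And>c x. f (c *\<^sub>C x) = c *\<^sub>C f x"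
    "\<And>x y. f (x + y) = f x + f y" "\<And>x y. f (x - y) = f x - f y" "f 0 = 0"
  using assms unfolding bounded_clinear_def
  by (auto simp: linear_simps bounded_linear.linear linear_0)

lemma bounded_clinear_bound:
  assumes "bounded_clinear f"
  obtains K where "K > 0" "\<And>x. norm (f x) \<le> K * norm x"
  using bounded_linear.pos_bounded[OF bounded_clinearD(1)[OF assms]] by (metis mult.commute)

lemma bounded_clinear_compose:
  assumes "bounded_clinear f" "bounded_clinear g"
  shows "bounded_clinear (\<lambda>x. f (g x))"
  using assms unfolding bounded_clinear_def by (auto intro: bounded_linear_compose)

lemma bounded_clinear_add:
  assumes "bounded_clinear f" "bounded_clinear g"
  shows "bounded_clinear (\<lambda>x. f x + g x)"
  using assms unfolding bounded_clinear_def by (auto intro: bounded_linear_add simp: scaleC_add_right)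

lemma bounded_clinear_diff:
  assumes "bounded_clinear f" "bounded_clinear g"
  shows "bounded_clinear (\<lambda>x. f x - g x)"
  using assms unfolding bounded_clinear_def by (auto intro: bounded_linear_sub simp: scaleC_diff_right)

lemma bounded_clinear_scaleC_const: "bounded_clinear (\<lambda>x. c *\<^sub>C x)"
  by (rule bounded_clinearI[of _ "cmod c"])
     (auto simp: scaleC_add_right scaleC_scaleC norm_scaleC mult.commute)

context
  fixes T :: "'a::krein_space \<Rightarrow> 'b::krein_space"
  assumes T: "bounded_clinear T"
begin

text \<open>
  The definite description in \<open>adj\<close> denotes the adjoint: it exists by the Riesz theorem and is
  unique because the form is nondegenerate.
\<close>

lemma ip_adj_right: "ip (T x) y = ip x (adj T y)"
proof -
  obtain C where C: "C > 0" "\<And>x y :: 'b. cmod (ip x y) \<le> C * norm x * norm y"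
    using ip_bounded by metis
  obtain K where K: "K > 0" "\<And>x. norm (T x) \<le> K * norm x"
    using bounded_clinear_bound[OF T] by metis
  have "\<exists>a. \<forall>x. ip (T x) y = ip x a" for y
  proof (rule Riesz_representation_krein[where B = "C * K * norm y"])
    fix x
    have "cmod (ip (T x) y) \<le> C * norm (T x) * norm y" by (rule C)
    also have "\<dots> \<le> C * (K * norm x) * norm y"
      using C K by (intro mult_right_mono mult_left_mono) auto
    finally show "cmod (ip (T x) y) \<le> C * K * norm y * norm x" by (simp add: mult_ac)
  qed (simp_all add: bounded_clinearD[OF T] ip.form_simps)
  then obtain S where S: "\<forall>x y. ip (T x) y = ip x (S y)" by metis
  have "\<forall>x y. ip (T x) y = ip x (adj T y)"
    unfolding adj_def
  proof (rule theI[where a = S])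
    fix S' assume S': "\<forall>x y. ip (T x) y = ip x (S' y)"
    show "S' = S"
    proof (intro ext ip_nondegenerate)
      show "ip x (S' y) = ip x (S y)" for x y
        using S'[rule_format, of x y, symmetric] S[rule_format, of x y] by (rule trans)
    qed
  qed (rule S)
  then show ?thesis by blast
qed

lemma ip_adj_left: "ip (adj T y) x = ip y (T x)"
  unfolding ip_commute[of "adj T y" x] ip_adj_right[symmetric] by (rule ip_commute[symmetric])

lemma bounded_clinear_adj: "bounded_clinear (adj T)"
proof -
  obtain C where C: "C > 0" "\<And>x y :: 'b. cmod (ip x y) \<le> C * norm x * norm y"
    using ip_bounded by metis
  obtain K where K: "K > 0" "\<And>x. norm (T x) \<le> K * norm x"
    using bounded_clinear_bound[OF T] by metis
  obtain L where L: "\<And>(x::'a) B. 0 \<le> B \<Longrightarrow> (\<And>y. cmod (ip x y) \<le> B * norm y) \<Longrightarrow> norm x \<le> L * B"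
    using norm_le_of_ip_le by metis
  show ?thesis
  proof (rule bounded_clinearI)
    show "adj T (x + y) = adj T x + adj T y" for x y
      by (rule ip_nondegenerate) (simp add: ip.form_simps ip_adj_right[symmetric])
    show "adj T (c *\<^sub>C x) = c *\<^sub>C adj T x" for c x
      by (rule ip_nondegenerate) (simp add: ip.form_simps ip_adj_right[symmetric])
    show "norm (adj T y) \<le> (L * (C * K)) * norm y" for y
    proof -
      have "norm (adj T y) \<le> L * (C * K * norm y)"
      proof (rule L)
        fix x
        have "cmod (ip (adj T y) x) \<le> C * norm y * norm (T x)" unfolding ip_adj_left by (rule C)
        also have "\<dots> \<le> C * norm y * (K * norm x)"
          using C K by (intro mult_left_mono) auto
        finally show "cmod (ip (adj T y) x) \<le> C * K * norm y * norm x" by (simp add: mult_ac)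
      qed (use C K in auto)
      then show ?thesis by (simp add: mult_ac)
    qed
  qed
qed

end

section \<open>Transporting operators from the Krein space to the Hilbert space\<close>

lemma csubspace_UNIV: "csubspace UNIV"
  by (simp add: csubspace_def)

lemma hilbert_on_closed:
  fixes S :: "'a::complex_hilbert_space set"
  assumes "csubspace S" "closed S"
  shows "hilbert_on ip S"
  unfolding hilbert_on_def
proof (intro conjI allI impI ballI)
  show "csubspace S" by fact
  show "0 < Re (ip u u)" if "u \<noteq> 0" for u :: 'a using that by (simp add: Re_ip_self)
next
  fix X :: "nat \<Rightarrow> 'a"
  assume X: "(\<forall>n. X n \<in> S) \<and> (\<forall>e>0. \<exists>n0. \<forall>m\<ge>n0. \<forall>n\<ge>n0. Re (ip (X m - X n) (X m - X n)) < e)"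
  then have "Cauchy X" by (intro Cauchy_of_norm_sq_diff) (simp add: Re_ip_self)
  then obtain L where L: "X \<longlonglongrightarrow> L" using Cauchy_convergent convergent_def by blast
  then have "L \<in> S" using closed_sequentially[OF assms(2)] X by blast
  moreover have "(\<lambda>n. (norm (X n - L))\<^sup>2) \<longlonglongrightarrow> (norm (L - L))\<^sup>2" by (intro tendsto_intros L)
  ultimately show "\<exists>x\<in>S. (\<lambda>n. Re (ip (X n - x) (X n - x))) \<longlonglongrightarrow> 0"
    by (auto simp: Re_ip_self)
qed

lemma cmod_ip_le: "cmod (ip x y) \<le> norm x * norm y" for x y :: "'a::complex_hilbert_space"
  using ip.Cauchy_Schwarz_sqrt[OF hilbert_on_closed[OF csubspace_UNIV closed_UNIV], of x y]
  by (simp add: Re_ip_self)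

lemma norm_sq_le_ip: "(norm x)\<^sup>2 \<le> cmod (ip x x)" for x :: "'a::complex_hilbert_space"
  using complex_Re_le_cmod[of "ip x x"] by (simp add: Re_ip_self)

lemma csubspace_closure:
  fixes S :: "'a::complex_normed_vector set"
  assumes "csubspace S"
  shows "csubspace (closure S)"
  unfolding csubspace_def
proof (intro conjI ballI allI)
  show "0 \<in> closure S" using csubspaceD(1)[OF assms] closure_subset by blast
next
  fix x y assume "x \<in> closure S" "y \<in> closure S"
  then obtain X Y where "\<forall>n. X n \<in> S" "X \<longlonglongrightarrow> x" "\<forall>n. Y n \<in> S" "Y \<longlonglongrightarrow> y"
    unfolding closure_sequential by blast
  then show "x + y \<in> closure S"
    unfolding closure_sequential
    by (intro exI[of _ "\<lambda>n. X n + Y n"]) (auto intro: tendsto_add csubspaceD(2)[OF assms])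
next
  fix c x assume "x \<in> closure S"
  then obtain X where X: "\<forall>n. X n \<in> S" "X \<longlonglongrightarrow> x"
    unfolding closure_sequential by blast
  have "(\<lambda>n. c *\<^sub>C X n) \<longlonglongrightarrow> c *\<^sub>C x"
    using bounded_linear.tendsto[OF bounded_clinearD(1)[OF bounded_clinear_scaleC_const] X(2)] .
  then show "c *\<^sub>C x \<in> closure S"
    unfolding closure_sequential using X(1)
    by (intro exI[of _ "\<lambda>n. c *\<^sub>C X n"]) (auto intro: csubspaceD(3)[OF assms])
qed

text \<open>
  The Riesz theorem on the closed subspace \<open>closure S\<close> provides the orthogonal projection \<open>a\<close> of a
  given \<open>v\<close>, and \<open>v - a\<close> is orthogonal to \<open>S\<close>.
\<close>

lemma dense_of_orthogonal_trivial:
  fixes S :: "'a::complex_hilbert_space set"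
  assumes S: "csubspace S" and orth: "\<And>v. (\<And>s. s \<in> S \<Longrightarrow> ip s v = 0) \<Longrightarrow> v = 0"
  shows "closure S = UNIV"
proof -
  have H: "hilbert_on ip (closure S)"
    by (rule hilbert_on_closed[OF csubspace_closure[OF S] closed_closure])
  have "v \<in> closure S" for v
  proof -
    have "\<exists>a\<in>closure S. \<forall>x\<in>closure S. ip x v = ip x a"
    proof (rule ip.Riesz_representation[OF H, where C = "(norm v)\<^sup>2"])
      fix x :: 'a
      have "(cmod (ip x v))\<^sup>2 \<le> (norm x * norm v)\<^sup>2" by (intro power_mono cmod_ip_le) simp
      then show "(cmod (ip x v))\<^sup>2 \<le> (norm v)\<^sup>2 * Re (ip x x)"
        by (simp add: Re_ip_self power_mult_distrib mult.commute)
    qed (simp_all add: ip.form_simps)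
    then obtain a where a: "a \<in> closure S" "\<And>x. x \<in> closure S \<Longrightarrow> ip x v = ip x a" by blast
    have "v - a = 0"
      by (rule orth) (use a(2) closure_subset in \<open>auto simp: ip.form_simps\<close>)
    then show ?thesis using a(1) by simp
  qed
  then show ?thesis by blast
qed

text \<open>
  Log-convexity means that the ratios \<open>a (n + 1) / a n\<close> increase. If the first ratio exceeded \<open>K\<close>,
  the sequence would therefore grow faster than any multiple of \<open>K ^ n\<close>.
\<close>

lemma log_convex_growth:
  fixes a :: "nat \<Rightarrow> real"
  assumes nonneg: "\<And>n. 0 \<le> a n" and convex: "\<And>n. (a (Suc n))\<^sup>2 \<le> a n * a (Suc (Suc n))"
    and growth: "\<And>n. a n \<le> M * K ^ n" and K: "0 < K"
  shows "a 1 \<le> K * a 0"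
proof (rule ccontr)
  assume "\<not> a 1 \<le> K * a 0"
  then have less: "K * a 0 < a 1" by simp
  have a0: "a 0 > 0"
  proof (rule ccontr)
    assume "\<not> a 0 > 0"
    then have "a 0 = 0" using nonneg[of 0] by simp
    then show False using convex[of 0] less by simp
  qed
  define r where "r = a 1 / a 0"
  have r: "K < r" using less a0 by (simp add: r_def field_simps)
  have step: "a n > 0 \<and> r * a n \<le> a (Suc n)" for n
  proof (induction n)
    case 0
    then show ?case using a0 by (simp add: r_def)
  next
    case (Suc n)
    then have "0 < r * a n" using r K by simp
    with Suc have pos: "a (Suc n) > 0" by linarith
    have "(r * a n) * a (Suc n) \<le> a (Suc n) * a (Suc n)" using Suc pos by simp
    also have "\<dots> \<le> a n * a (Suc (Suc n))" using convex[of n] by (simp add: power2_eq_square)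
    finally have "a n * (r * a (Suc n)) \<le> a n * a (Suc (Suc n))" by (simp add: mult_ac)
    then show ?case using Suc pos by simp
  qed
  have lower: "r ^ n * a 0 \<le> a n" for n
  proof (induction n)
    case (Suc n)
    have "r ^ Suc n * a 0 \<le> r * a n" using Suc r K by (simp add: mult.assoc)
    also have "\<dots> \<le> a (Suc n)" using step by blast
    finally show ?case .
  qed simp
  have "1 < r / K" using r K by simp
  then obtain n where "M / a 0 < (r / K) ^ n" using real_arch_pow by blast
  then have "M * K ^ n < r ^ n * a 0" using a0 K by (simp add: field_simps)
  then show False using lower[of n] growth[of n] by linarith
qed

text \<open>
  Both sides of the identity \<open>[T T* x, y] = [x, T T* y]\<close> are the inner product of \<open>T* x\<close> and
  \<open>T* y\<close>. When the domain of \<open>T\<close> is a Hilbert space, this is how the indefinite form meets a norm.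
\<close>

lemma ip_TT_adj:
  assumes "bounded_clinear (T :: 'v::krein_space \<Rightarrow> 'k::krein_space)"
  shows "ip (T (adj T x)) y = ip (adj T x) (adj T y)" "ip x (T (adj T y)) = ip (adj T x) (adj T y)"
  by (simp add: ip_adj_right[OF assms], simp add: ip_adj_left[OF assms])

lemma adj_commutes_TT_adj:
  fixes T :: "'v::krein_space \<Rightarrow> 'k::krein_space" and C :: "'k \<Rightarrow> 'k"
  assumes T: "bounded_clinear T" and C: "bounded_clinear C"
    and comm: "\<And>x. C (T (adj T x)) = T (adj T (C x))"
  shows "adj C (T (adj T y)) = T (adj T (adj C y))"
proof (rule ip_nondegenerate)
  fix x
  have "ip x (adj C (T (adj T y))) = ip (T (adj T (C x))) y"
    unfolding ip_adj_right[OF C, symmetric] ip_TT_adj[OF T] ..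
  also have "\<dots> = ip x (T (adj T (adj C y)))"
    unfolding comm[symmetric] ip_adj_right[OF C] ip_TT_adj[OF T] ..
  finally show "ip x (adj C (T (adj T y))) = ip x (T (adj T (adj C y)))" .
qed

context
  fixes T :: "'v::complex_hilbert_space \<Rightarrow> 'k::krein_space"
  assumes T: "bounded_clinear T" and inj: "inj T"
begin

text \<open>
  A vector \<open>v\<close> orthogonal to the range of \<open>T*\<close> satisfies \<open>[y, T v] = 0\<close> for all \<open>y\<close>, and \<open>T\<close> is
  injective.
\<close>

lemma dense_range_adj: "closure (range (adj T)) = UNIV"
proof (rule dense_of_orthogonal_trivial)
  note lin = bounded_clinearD(2-)[OF bounded_clinear_adj[OF T], symmetric]
  show "csubspace (range (adj T))"
    unfolding csubspace_def
  proof (intro conjI ballI allI)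
    show "0 \<in> range (adj T)" by (subst lin(4)) simp
    show "x + y \<in> range (adj T)" if "x \<in> range (adj T)" "y \<in> range (adj T)" for x y
      using that by (auto simp: lin(2))
    show "c *\<^sub>C x \<in> range (adj T)" if "x \<in> range (adj T)" for c x
      using that by (auto simp: lin(1))
  qed
  fix v assume "\<And>s. s \<in> range (adj T) \<Longrightarrow> ip s v = 0"
  then have "ip y (T v) = ip y 0" for y
    by (simp add: ip_adj_left[OF T, symmetric] ip.zero_right)
  then have "T v = T 0" unfolding bounded_clinearD(5)[OF T] by (rule ip_nondegenerate)
  then show "v = 0" using inj by (simp add: inj_eq)
qed

lemma eq_of_ip_adj_range:
  assumes "\<And>y. ip v (adj T y) = ip w (adj T y)"
  shows "v = w"
proof -
  have "ip (T v) y = ip (T w) y" for y unfolding ip_adj_right[OF T] by (rule assms)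
  then have "ip y (T v) = ip y (T w)" for y
    using ip_commute[of y "T v"] ip_commute[of y "T w"] by simp
  then have "T v = T w" by (rule ip_nondegenerate)
  then show ?thesis using inj by (simp add: inj_eq)
qed

end

lemma norm_funpow_le:
  fixes f :: "'a::real_normed_vector \<Rightarrow> 'a"
  assumes "\<And>x. norm (f x) \<le> K * norm x" "0 \<le> K"
  shows "norm ((f ^^ n) x) \<le> K ^ n * norm x"
proof (induction n)
  case (Suc n)
  have "norm ((f ^^ Suc n) x) \<le> K * norm ((f ^^ n) x)" using assms(1) by simp
  also have "\<dots> \<le> K * (K ^ n * norm x)" using Suc assms(2) by (rule mult_left_mono)
  finally show ?case by simp
qed simp

context
  fixes T :: "'v::complex_hilbert_space \<Rightarrow> 'k::krein_space" and C :: "'k \<Rightarrow> 'k"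
  assumes T: "bounded_clinear T" and inj: "inj T" and C: "bounded_clinear C"
    and comm: "\<And>x. C (T (adj T x)) = T (adj T (C x))"
begin

text \<open>
  The map \<open>T* y \<mapsto> T* C y\<close> is bounded in the norm of the Hilbert space, although nothing bounds \<open>C\<close>
  in terms of the seminorm \<open>\<parallel>T* y\<parallel>\<close> to begin with. Following Lax, put \<open>H = C* C\<close>, which is
  symmetric for the semidefinite form \<open>[T T* x, y]\<close>. By the Cauchy-Schwarz inequality the numbers
  \<open>\<parallel>T* H^n y\<parallel>\<close> are log-convex in \<open>n\<close>; they grow at most like \<open>K ^ n\<close> with \<open>K\<close> a norm bound of \<open>H\<close>
  on the Krein space, so \<open>\<parallel>T* H y\<parallel> \<le> K \<parallel>T* y\<parallel>\<close>.
\<close>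

lemma Lax_bound:
  obtains k where "0 < k" "\<And>y. norm (adj T (C y)) \<le> k * norm (adj T y)"
proof -
  define H where "H = (\<lambda>x. adj C (C x))"
  have Hb: "bounded_clinear H"
    unfolding H_def by (rule bounded_clinear_compose[OF bounded_clinear_adj[OF C] C])
  obtain K where K: "K > 0" "\<And>x. norm (H x) \<le> K * norm x"
    by (rule bounded_clinear_bound[OF Hb]) (rule that)
  obtain L where L: "L > 0" "\<And>x. norm (adj T x) \<le> L * norm x"
    by (rule bounded_clinear_bound[OF bounded_clinear_adj[OF T]]) (rule that)
  have H_comm: "H (T (adj T x)) = T (adj T (H x))" for x
    unfolding H_def comm adj_commutes_TT_adj[OF T C comm] ..
  have move: "ip (adj T (C x)) (adj T (C y)) = ip (adj T x) (adj T (H y))" for x y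
    unfolding H_def ip_TT_adj(1)[OF T, symmetric] comm[symmetric] ip_adj_right[OF C] ..
  have H_self: "ip (adj T (H x)) (adj T y) = ip (adj T x) (adj T (H y))" for x y
  proof -
    have "ip (adj T (H x)) (adj T y) = cnj (ip (adj T y) (adj T (H x)))" by (rule ip_commute)
    also have "\<dots> = ip (adj T (C x)) (adj T (C y))"
      unfolding move[symmetric] by (rule ip_commute[symmetric])
    finally show ?thesis unfolding move .
  qed
  have bound: "norm (adj T (H y)) \<le> K * norm (adj T y)" for y
  proof -
    define a where "a = (\<lambda>n. norm (adj T ((H ^^ n) y)))"
    have "a 1 \<le> K * a 0"
    proof (rule log_convex_growth)
      show "0 \<le> a n" for n by (simp add: a_def)
      show "a n \<le> (L * norm y) * K ^ n" for n
      proof -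
        have "a n \<le> L * norm ((H ^^ n) y)" unfolding a_def by (rule L)
        also have "\<dots> \<le> L * (K ^ n * norm y)"
          using norm_funpow_le[of H K, OF K(2)] K(1) L(1) by (intro mult_left_mono) auto
        finally show ?thesis by (simp only: mult_ac)
      qed
      show "(a (Suc n))\<^sup>2 \<le> a n * a (Suc (Suc n))" for n
      proof -
        let ?z = "(H ^^ n) y"
        have "(a (Suc n))\<^sup>2 \<le> cmod (ip (adj T (H ?z)) (adj T (H ?z)))"
          unfolding a_def funpow.simps o_apply by (rule norm_sq_le_ip)
        also have "\<dots> = cmod (ip (adj T ?z) (adj T (H (H ?z))))" unfolding H_self ..
        also have "\<dots> \<le> a n * a (Suc (Suc n))"
          unfolding a_def funpow.simps o_apply by (rule cmod_ip_le)
        finally show ?thesis .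
      qed
    qed (rule K)
    then show ?thesis by (simp add: a_def)
  qed
  have "norm (adj T (C y)) \<le> sqrt K * norm (adj T y)" for y
  proof -
    have "(norm (adj T (C y)))\<^sup>2 \<le> cmod (ip (adj T (C y)) (adj T (C y)))" by (rule norm_sq_le_ip)
    also have "\<dots> = cmod (ip (adj T y) (adj T (H y)))" unfolding move ..
    also have "\<dots> \<le> norm (adj T y) * norm (adj T (H y))" by (rule cmod_ip_le)
    also have "\<dots> \<le> norm (adj T y) * (K * norm (adj T y))"
      using bound by (rule mult_left_mono) simp
    finally have "(norm (adj T (C y)))\<^sup>2 \<le> K * (norm (adj T y))\<^sup>2"
      by (simp only: power2_eq_square mult_ac)
    from sqrt_le_sqrt_mult[OF this norm_ge_zero]
    show ?thesis unfolding real_sqrt_abs abs_norm_cancel .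
  qed
  then show thesis using that[of "sqrt K"] K(1) by simp
qed

text \<open>
  \<open>C T x\<close> lies in the range of \<open>T\<close>: this is clear for \<open>x = T* y\<close>, where \<open>C T T* y = T T* C y\<close>, and
  the bound on \<open>T* y \<mapsto> T* C y\<close> carries it over to limits of such \<open>x\<close>, which are all vectors.
\<close>

lemma range_invariant:
  obtains k where "0 < k" "\<And>x. \<exists>v. T v = C (T x) \<and> norm v \<le> k * norm x"
proof -
  obtain k where k: "0 < k" "\<And>y. norm (adj T (C y)) \<le> k * norm (adj T y)"
    by (rule Lax_bound) (rule that)
  note Tlin = bounded_clinearD[OF T] and Clin = bounded_clinearD[OF C]
    and Alin = bounded_clinearD[OF bounded_clinear_adj[OF T]]
  have "\<exists>v. T v = C (T x) \<and> norm v \<le> k * norm x" for x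
  proof -
    have "x \<in> closure (range (adj T))" using dense_range_adj[OF T inj] by simp
    then obtain X where X: "\<forall>n. X n \<in> range (adj T)" "X \<longlonglongrightarrow> x"
      unfolding closure_sequential by blast
    then have "\<forall>n. \<exists>y. X n = adj T y" by (auto simp: image_iff)
    from choice[OF this] obtain Y where Y: "\<forall>n. X n = adj T (Y n)" by (elim exE)
    define V where "V = (\<lambda>n. adj T (C (Y n)))"
    have "Cauchy V"
      unfolding Cauchy_def dist_norm
    proof (intro allI impI)
      fix e :: real assume "e > 0"
      then have "e / k > 0" using k by simp
      then obtain N where N: "\<And>m n. m \<ge> N \<Longrightarrow> n \<ge> N \<Longrightarrow> norm (X m - X n) < e / k"
        using LIMSEQ_imp_Cauchy[OF X(2)] unfolding Cauchy_def dist_norm by blast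
      have "norm (V m - V n) < e" if "m \<ge> N" "n \<ge> N" for m n
      proof -
        have "norm (V m - V n) = norm (adj T (C (Y m - Y n)))"
          by (simp add: V_def Clin Alin)
        also have "\<dots> \<le> k * norm (X m - X n)"
          using k(2)[of "Y m - Y n"] by (simp add: Y Alin)
        also have "\<dots> < e" using N[OF that] k by (simp add: field_simps)
        finally show ?thesis .
      qed
      then show "\<exists>M. \<forall>m\<ge>M. \<forall>n\<ge>M. norm (V m - V n) < e" by blast
    qed
    then obtain v where v: "V \<longlonglongrightarrow> v" using Cauchy_convergent convergent_def by blast
    have "(\<lambda>n. T (V n)) \<longlonglongrightarrow> T v" by (rule bounded_linear.tendsto[OF Tlin(1) v])
    moreover have "T (V n) = C (T (X n))" for n by (simp add: V_def Y comm)
    moreover have "(\<lambda>n. C (T (X n))) \<longlonglongrightarrow> C (T x)"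
      by (intro bounded_linear.tendsto[OF Clin(1)] bounded_linear.tendsto[OF Tlin(1)] X)
    ultimately have "T v = C (T x)" using LIMSEQ_unique by auto
    moreover have "norm v \<le> k * norm x"
    proof (rule LIMSEQ_le)
      show "(\<lambda>n. norm (V n)) \<longlonglongrightarrow> norm v" by (intro tendsto_intros v)
      show "(\<lambda>n. k * norm (X n)) \<longlonglongrightarrow> k * norm x" by (intro tendsto_intros X)
      show "\<exists>N. \<forall>n\<ge>N. norm (V n) \<le> k * norm (X n)" using k(2) by (auto simp: V_def Y)
    qed
    ultimately show ?thesis by blast
  qed
  then show thesis using that k(1) by blast
qed

text \<open>
  \<open>C\<close> maps the range of \<open>T\<close> into itself, so the inverse of \<open>T\<close> in the definition of \<open>Theta\<close> is
  applied to vectors in that range only. As \<open>T\<close> is injective, the identity determines \<open>Theta T C\<close>.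
\<close>

lemma T_Theta: "T (Theta T C x) = C (T x)"
proof -
  obtain k where "\<And>x. \<exists>v. T v = C (T x) \<and> norm v \<le> k * norm x"
    by (rule range_invariant) (rule that)
  then obtain v where v: "T v = C (T x)" by blast
  show ?thesis unfolding Theta_def o_apply by (rule f_inv_into_f) (simp add: v[symmetric])
qed

lemma Theta_eqI: "T v = C (T x) \<Longrightarrow> Theta T C x = v"
  by (rule injD[OF inj]) (simp add: T_Theta)

lemma bounded_clinear_Theta: "bounded_clinear (Theta T C)"
proof -
  note Tlin = bounded_clinearD[OF T] and Clin = bounded_clinearD[OF C]
  obtain k where k: "\<And>x. \<exists>v. T v = C (T x) \<and> norm v \<le> k * norm x"
    by (rule range_invariant) (rule that)
  show ?thesis
  proof (rule bounded_clinearI)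
    show "Theta T C (x + y) = Theta T C x + Theta T C y" for x y
      by (rule Theta_eqI) (simp add: Tlin Clin T_Theta)
    show "Theta T C (c *\<^sub>C x) = c *\<^sub>C Theta T C x" for c x
      by (rule Theta_eqI) (simp add: Tlin Clin T_Theta)
    show "norm (Theta T C x) \<le> k * norm x" for x
      using k[of x] by (auto dest: Theta_eqI)
  qed
qed

end

lemma adj_Theta:
  fixes T :: "'v::complex_hilbert_space \<Rightarrow> 'k::krein_space" and C :: "'k \<Rightarrow> 'k"
  assumes T: "bounded_clinear T" and inj: "inj T" and C: "bounded_clinear C"
    and comm: "\<And>x. C (T (adj T x)) = T (adj T (C x))"
  shows "adj (Theta T C) = Theta T (adj C)"
proof
  fix w
  note comm' = adj_commutes_TT_adj[OF T C comm]
  note C' = bounded_clinear_adj[OF C]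
  note Th = bounded_clinear_Theta[OF T inj C comm]
  show "adj (Theta T C) w = Theta T (adj C) w"
  proof (rule eq_of_ip_adj_range[OF T inj])
    fix y
    have Th_adj: "Theta T C (adj T y) = adj T (C y)"
      by (rule Theta_eqI[OF T inj C comm]) (simp only: comm)
    have "ip (adj (Theta T C) w) (adj T y) = ip w (adj T (C y))"
      unfolding ip_adj_left[OF Th] Th_adj ..
    also have "\<dots> = ip (adj C (T w)) y"
      unfolding ip_adj_left[OF C] ip_adj_right[OF T] ..
    also have "\<dots> = ip (T (Theta T (adj C) w)) y"
      unfolding T_Theta[OF T inj C' comm'] ..
    also have "\<dots> = ip (Theta T (adj C) w) (adj T y)" by (rule ip_adj_right[OF T])
    finally show "ip (adj (Theta T C) w) (adj T y) = ip (Theta T (adj C) w) (adj T y)" .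
  qed
qed

section \<open>The spectrum of a normal operator\<close>

lemma norm_adj_normal:
  fixes E :: "'v::complex_hilbert_space \<Rightarrow> 'v"
  assumes E: "bounded_clinear E" and normal: "\<And>x. E (adj E x) = adj E (E x)"
  shows "norm (adj E x) = norm (E x)"
proof -
  have "ip (adj E x) (adj E x) = ip x (adj E (E x))"
    unfolding ip_adj_left[OF E] normal ..
  also have "\<dots> = ip (E x) (E x)" unfolding ip_adj_right[OF E] ..
  finally have "(norm (adj E x))\<^sup>2 = (norm (E x))\<^sup>2" by (simp add: Re_ip_self[symmetric])
  then show ?thesis by simp
qed

text \<open>
  Since \<open>E\<close> is bounded below, \<open>[E x, E y]\<close> is a complete inner product. Representing the
  functional \<open>[x, y]\<close> in it gives \<open>a\<close> with \<open>[x, y] = [E x, E a]\<close> for all \<open>x\<close>, that is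
  \<open>y = E* E a = E (E* a)\<close>, and \<open>E\<close> is surjective.
\<close>

lemma normal_bounded_below_invertible:
  fixes E :: "'v::complex_hilbert_space \<Rightarrow> 'v"
  assumes E: "bounded_clinear E" and normal: "\<And>x. E (adj E x) = adj E (E x)"
    and below: "\<And>x. norm x \<le> k * norm (E x)"
  shows "\<exists>S. bounded_clinear S \<and> S \<circ> E = id \<and> E \<circ> S = id"
proof -
  note lin = bounded_clinearD[OF E]
  define f where "f = (\<lambda>x y. ip (E x) (E y))"
  have f_self: "Re (f x x) = (norm (E x))\<^sup>2" for x by (simp add: f_def Re_ip_self)
  interpret f: hermitian_form f
    by unfold_locales (simp_all add: f_def lin ip.form_simps ip_commute[symmetric])
  have inj: "x = 0" if "E x = 0" for x using below[of x] that by simp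
  have H: "hilbert_on f UNIV"
    unfolding hilbert_on_def
  proof (intro conjI allI impI ballI)
    show "csubspace UNIV" by (rule csubspace_UNIV)
    show "0 < Re (f u u)" if "u \<noteq> 0" for u using inj[of u] that by (auto simp: f_self)
  next
    fix X :: "nat \<Rightarrow> 'v"
    assume X: "(\<forall>n. X n \<in> UNIV) \<and> (\<forall>e>0. \<exists>n0. \<forall>m\<ge>n0. \<forall>n\<ge>n0. Re (f (X m - X n) (X m - X n)) < e)"
    then have EX: "Cauchy (\<lambda>n. E (X n))"
      by (intro Cauchy_of_norm_sq_diff) (simp add: f_self lin)
    have "Cauchy X"
      unfolding Cauchy_def dist_norm
    proof (intro allI impI)
      fix e :: real assume "e > 0"
      then have "e / (\<bar>k\<bar> + 1) > 0" by simp
      then obtain N where N: "\<forall>m\<ge>N. \<forall>n\<ge>N. norm (E (X m) - E (X n)) < e / (\<bar>k\<bar> + 1)"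
        using EX unfolding Cauchy_def dist_norm by blast
      have "norm (X m - X n) < e" if "m \<ge> N" "n \<ge> N" for m n
      proof -
        have "norm (X m - X n) \<le> k * norm (E (X m) - E (X n))"
          using below[of "X m - X n"] by (simp add: lin)
        also have "\<dots> \<le> (\<bar>k\<bar> + 1) * norm (E (X m) - E (X n))"
          by (intro mult_right_mono) auto
        also have "\<dots> < e" using N that by (simp add: field_simps)
        finally show ?thesis .
      qed
      then show "\<exists>M. \<forall>m\<ge>M. \<forall>n\<ge>M. norm (X m - X n) < e" by blast
    qed
    then obtain L where L: "X \<longlonglongrightarrow> L" using Cauchy_convergent convergent_def by blast
    then have "(\<lambda>n. (norm (E (X n) - E L))\<^sup>2) \<longlonglongrightarrow> (norm (E L - E L))\<^sup>2"
      by (intro tendsto_intros bounded_linear.tendsto[OF lin(1)])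
    then show "\<exists>x\<in>UNIV. (\<lambda>n. Re (f (X n - x) (X n - x))) \<longlonglongrightarrow> 0"
      by (intro bexI[of _ L]) (simp_all add: f_self lin)
  qed
  have surj: "\<exists>x. E x = y" for y
  proof -
    have "\<exists>a\<in>UNIV. \<forall>x\<in>UNIV. ip x y = f x a"
    proof (rule f.Riesz_representation[OF H, where C = "(k * norm y)\<^sup>2"])
      fix x :: 'v
      have "cmod (ip x y) \<le> norm x * norm y" by (rule cmod_ip_le)
      also have "\<dots> \<le> (k * norm (E x)) * norm y" using below by (rule mult_right_mono) simp
      finally have "(cmod (ip x y))\<^sup>2 \<le> ((k * norm (E x)) * norm y)\<^sup>2" by (rule power_mono) simp
      then show "(cmod (ip x y))\<^sup>2 \<le> (k * norm y)\<^sup>2 * Re (f x x)"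
        unfolding f_self by (simp add: power_mult_distrib mult_ac)
    qed (simp_all add: ip.form_simps)
    then obtain a where a: "\<And>x. ip x y = f x a" by blast
    have "y = adj E (E a)"
      by (rule ip_nondegenerate) (simp only: a f_def ip_adj_right[OF E])
    then have "E (adj E a) = y" by (simp only: normal)
    then show ?thesis by blast
  qed
  define S where "S = inv E"
  have injE: "inj E"
  proof (rule injI)
    fix x y assume "E x = E y"
    then have "E (x - y) = 0" by (simp add: lin)
    then show "x = y" using inj[of "x - y"] by simp
  qed
  have ES: "E (S y) = y" for y unfolding S_def by (rule surj_f_inv_f) (use surj in \<open>auto simp: surj_def eq_commute\<close>)
  have SE: "S (E x) = x" for x unfolding S_def using injE by (rule inv_f_f)
  have "bounded_clinear S"
  proof (rule bounded_clinearI)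
    show "S (x + y) = S x + S y" for x y by (rule injD[OF injE]) (simp add: ES lin)
    show "S (c *\<^sub>C x) = c *\<^sub>C S x" for c x by (rule injD[OF injE]) (simp add: ES lin)
    show "norm (S x) \<le> k * norm x" for x using below[of "S x"] by (simp add: ES)
  qed
  then show ?thesis using ES SE by (intro exI[of _ S]) (auto simp: fun_eq_iff)
qed

context
  fixes M :: "'v::complex_hilbert_space \<Rightarrow> 'v"
  assumes normal: "normal_op M"
begin

lemma normal_op_bounded: "bounded_clinear M"
  using normal unfolding normal_op_def by blast

lemma normal_op_commute: "M (adj M x) = adj M (M x)"
  using normal unfolding normal_op_def by (metis o_apply)

lemma bounded_clinear_shift: "bounded_clinear (\<lambda>x. M x - z *\<^sub>C x)"
  by (rule bounded_clinear_diff[OF normal_op_bounded bounded_clinear_scaleC_const])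

lemma adj_shift: "adj (\<lambda>x. M x - z *\<^sub>C x) y = adj M y - cnj z *\<^sub>C y"
  by (rule ip_nondegenerate)
     (simp add: ip_adj_right[OF bounded_clinear_shift, symmetric] ip.form_simps
        ip_adj_right[OF normal_op_bounded, symmetric])

lemma norm_adj_shift: "norm (adj M x - cnj z *\<^sub>C x) = norm (M x - z *\<^sub>C x)"
proof -
  note lin = bounded_clinearD[OF normal_op_bounded] bounded_clinearD[OF bounded_clinear_adj[OF normal_op_bounded]]
  have "norm (adj (\<lambda>x. M x - z *\<^sub>C x) x) = norm (M x - z *\<^sub>C x)"
    by (rule norm_adj_normal[OF bounded_clinear_shift])
       (simp add: adj_shift lin normal_op_commute scaleC_diff_right scaleC_scaleC mult.commute algebra_simps)
  then show ?thesis unfolding adj_shift .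
qed

lemma not_in_spectrum_iff:
  "z \<notin> op_spectrum M \<longleftrightarrow> (\<exists>k>0. \<forall>x. norm x \<le> k * norm (M x - z *\<^sub>C x))"
proof
  assume "z \<notin> op_spectrum M"
  then obtain S where S: "bounded_clinear S" "S \<circ> (\<lambda>x. M x - z *\<^sub>C x) = id"
    unfolding op_spectrum_def by blast
  obtain k where k: "k > 0" "\<And>x. norm (S x) \<le> k * norm x"
    by (rule bounded_clinear_bound[OF S(1)]) (rule that)
  have "norm x \<le> k * norm (M x - z *\<^sub>C x)" for x
    using k(2)[of "M x - z *\<^sub>C x"] fun_cong[OF S(2), of x] by simp
  then show "\<exists>k>0. \<forall>x. norm x \<le> k * norm (M x - z *\<^sub>C x)" using k(1) by blast
next
  note lin = bounded_clinearD[OF normal_op_bounded] bounded_clinearD[OF bounded_clinear_adj[OF normal_op_bounded]]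
  assume "\<exists>k>0. \<forall>x. norm x \<le> k * norm (M x - z *\<^sub>C x)"
  then obtain k where k: "\<And>x. norm x \<le> k * norm (M x - z *\<^sub>C x)" by blast
  have "\<exists>S. bounded_clinear S \<and> S \<circ> (\<lambda>x. M x - z *\<^sub>C x) = id \<and> (\<lambda>x. M x - z *\<^sub>C x) \<circ> S = id"
    by (rule normal_bounded_below_invertible[OF bounded_clinear_shift _ k])
       (simp add: adj_shift lin normal_op_commute scaleC_diff_right scaleC_scaleC mult.commute algebra_simps)
  then show "z \<notin> op_spectrum M" unfolding op_spectrum_def by blast
qed

text \<open>
  The spectrum of a normal operator is an approximate point spectrum, and normality makes the
  approximate eigenvectors serve the adjoint too.
\<close>

lemma approximate_eigenvectors:
  assumes "z \<in> op_spectrum M"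
  obtains X where "\<And>n::nat. norm (X n) = 1" "(\<lambda>n. M (X n) - z *\<^sub>C X n) \<longlonglongrightarrow> 0"
    "(\<lambda>n. adj M (X n) - cnj z *\<^sub>C X n) \<longlonglongrightarrow> 0"
proof -
  note lin = bounded_clinearD[OF normal_op_bounded]
  have "\<exists>u. norm u = 1 \<and> norm (M u - z *\<^sub>C u) \<le> 1 / real (Suc n)" for n
  proof -
    have "\<not> (\<exists>k>0. \<forall>x. norm x \<le> k * norm (M x - z *\<^sub>C x))"
      using assms not_in_spectrum_iff by blast
    then have "\<not> (\<forall>x. norm x \<le> real (Suc n) * norm (M x - z *\<^sub>C x))"
      using of_nat_0_less_iff zero_less_Suc by blast
    then obtain x where x: "real (Suc n) * norm (M x - z *\<^sub>C x) < norm x"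
      by (auto simp: not_le)
    have nx: "norm x > 0"
      using x by (rule le_less_trans[rotated]) simp
    define u where "u = of_real (1 / norm x) *\<^sub>C x"
    have "M u - z *\<^sub>C u = of_real (1 / norm x) *\<^sub>C (M x - z *\<^sub>C x)"
      by (simp add: u_def lin scaleC_diff_right scaleC_scaleC mult.commute)
    then have "norm (M u - z *\<^sub>C u) = norm (M x - z *\<^sub>C x) / norm x"
      by (simp add: norm_scaleC norm_divide)
    also have "\<dots> \<le> 1 / real (Suc n)" using x nx by (simp add: field_simps)
    finally have "norm (M u - z *\<^sub>C u) \<le> 1 / real (Suc n)" .
    moreover have "norm u = 1" using nx by (simp add: u_def norm_scaleC norm_divide)
    ultimately show ?thesis by blast
  qed
  then have "\<forall>n. \<exists>u. norm u = 1 \<and> norm (M u - z *\<^sub>C u) \<le> 1 / real (Suc n)" ..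
  from choice[OF this]
  obtain X where X: "\<forall>n. norm (X n) = 1 \<and> norm (M (X n) - z *\<^sub>C X n) \<le> 1 / real (Suc n)"
    by (elim exE)
  have lim: "(\<lambda>n. 1 / real (Suc n)) \<longlonglongrightarrow> 0" by (intro LIMSEQ_Suc lim_1_over_n)
  show thesis
  proof (rule that)
    show "norm (X n) = 1" for n using X by blast
    show "(\<lambda>n. M (X n) - z *\<^sub>C X n) \<longlonglongrightarrow> 0"
      by (rule Lim_null_comparison[OF always_eventually lim]) (use X in blast)
    show "(\<lambda>n. adj M (X n) - cnj z *\<^sub>C X n) \<longlonglongrightarrow> 0"
      by (rule Lim_null_comparison[OF always_eventually lim]) (use X norm_adj_shift in auto)
  qed
qed

lemma compact_op_spectrum: "compact (op_spectrum M)"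
proof (rule compact_eq_bounded_closed[THEN iffD2, OF conjI])
  obtain K where K: "\<And>x. norm (M x) \<le> K * norm x"
    by (rule bounded_clinear_bound[OF normal_op_bounded]) (rule that)
  show "bounded (op_spectrum M)"
    unfolding bounded_iff
  proof (intro exI[of _ K] ballI)
    fix z assume "z \<in> op_spectrum M"
    then obtain X where X: "\<And>n::nat. norm (X n) = 1" "(\<lambda>n. M (X n) - z *\<^sub>C X n) \<longlonglongrightarrow> 0"
      by (rule approximate_eigenvectors) (rule that)
    have "cmod z - K \<le> norm (M (X n) - z *\<^sub>C X n)" for n
      using norm_triangle_ineq2[of "z *\<^sub>C X n" "M (X n)"] K[of "X n"]
      by (simp add: norm_scaleC X(1) norm_minus_commute)
    moreover have "(\<lambda>n. norm (M (X n) - z *\<^sub>C X n)) \<longlonglongrightarrow> norm (0::'v)"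
      by (intro tendsto_norm X)
    ultimately have "cmod z - K \<le> norm (0::'v)"
      by (intro LIMSEQ_le_const) auto
    then show "cmod z \<le> K" by simp
  qed
  show "closed (op_spectrum M)"
    unfolding closed_def open_dist
  proof (intro ballI)
    fix z assume "z \<in> - op_spectrum M"
    then obtain k where k: "k > 0" "\<And>x. norm x \<le> k * norm (M x - z *\<^sub>C x)"
      using not_in_spectrum_iff by blast
    have "y \<in> - op_spectrum M" if y: "dist y z < 1 / (2 * k)" for y
    proof -
      have "norm x \<le> (2 * k) * norm (M x - y *\<^sub>C x)" for x
      proof -
        have split: "M x - z *\<^sub>C x = (M x - y *\<^sub>C x) + (y - z) *\<^sub>C x"
          by (simp add: scaleC_diff_left)
        have "norm (M x - z *\<^sub>C x) \<le> norm (M x - y *\<^sub>C x) + norm ((y - z) *\<^sub>C x)"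
          unfolding split by (rule norm_triangle_ineq)
        also have "norm ((y - z) *\<^sub>C x) = dist y z * norm x"
          by (simp add: norm_scaleC dist_norm)
        also have "norm (M x - y *\<^sub>C x) + dist y z * norm x
            \<le> norm (M x - y *\<^sub>C x) + 1 / (2 * k) * norm x"
          using y by (intro add_left_mono mult_right_mono) auto
        finally have "k * norm (M x - z *\<^sub>C x) \<le> k * (norm (M x - y *\<^sub>C x) + 1 / (2 * k) * norm x)"
          using k(1) by simp
        then have "norm x \<le> k * (norm (M x - y *\<^sub>C x) + 1 / (2 * k) * norm x)"
          using k(2)[of x] by simp
        then show ?thesis using k(1) by (simp add: field_simps)
      qed
      then show ?thesis using not_in_spectrum_iff[of y] k(1) by (auto intro!: exI[of _ "2 * k"])
    qed
    then show "\<exists>e>0. \<forall>y. dist y z < e \<longrightarrow> y \<in> - op_spectrum M"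
      using k(1) by (intro exI[of _ "1 / (2 * k)"]) auto
  qed
qed

end

section \<open>Polynomials of the real and imaginary parts on the spectrum\<close>

lemma op_poly_intertwine:
  assumes T: "bounded_linear T" and inter: "\<And>x. T (a x) = A (T x)"
  shows "T (op_poly p a x) = op_poly p A (T x)"
proof -
  have pow: "T ((a ^^ n) x) = (A ^^ n) (T x)" for n
    by (induction n) (simp_all add: inter)
  show ?thesis
    unfolding op_poly_def
    by (simp add: linear_sum[OF bounded_linear.linear[OF T]] linear_cmul[OF bounded_linear.linear[OF T]] pow)
qed

lemma op_poly_approximate_eigenvector:
  fixes A :: "'a::real_normed_vector \<Rightarrow> 'a"
  assumes A: "bounded_linear A" and X: "(\<lambda>n. A (X n) - \<alpha> *\<^sub>R X n) \<longlonglongrightarrow> 0"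
  shows "(\<lambda>n. op_poly p A (X n) - poly p \<alpha> *\<^sub>R X n) \<longlonglongrightarrow> 0"
proof -
  have pow: "(\<lambda>n. (A ^^ k) (X n) - \<alpha> ^ k *\<^sub>R X n) \<longlonglongrightarrow> 0" for k
  proof (induction k)
    case (Suc k)
    have "(\<lambda>n. A ((A ^^ k) (X n) - \<alpha> ^ k *\<^sub>R X n) + \<alpha> ^ k *\<^sub>R (A (X n) - \<alpha> *\<^sub>R X n))
        \<longlonglongrightarrow> A 0 + \<alpha> ^ k *\<^sub>R 0"
      by (intro tendsto_intros bounded_linear.tendsto[OF A] Suc X)
    moreover have "A ((A ^^ k) (X n) - \<alpha> ^ k *\<^sub>R X n) + \<alpha> ^ k *\<^sub>R (A (X n) - \<alpha> *\<^sub>R X n)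
        = (A ^^ Suc k) (X n) - \<alpha> ^ Suc k *\<^sub>R X n" for n
      by (simp add: linear_simps[OF A] scaleR_diff_right mult.commute)
    moreover have "A 0 + \<alpha> ^ k *\<^sub>R 0 = 0" by (simp add: linear_simps[OF A])
    ultimately show ?case by (simp only:)
  qed simp
  have "(\<lambda>n. \<Sum>i\<le>degree p. coeff p i *\<^sub>R ((A ^^ i) (X n) - \<alpha> ^ i *\<^sub>R X n))
      \<longlonglongrightarrow> (\<Sum>i\<le>degree p. coeff p i *\<^sub>R 0)"
    by (intro tendsto_intros pow)
  moreover have "(\<Sum>i\<le>degree p. coeff p i *\<^sub>R ((A ^^ i) (X n) - \<alpha> ^ i *\<^sub>R X n))
      = op_poly p A (X n) - poly p \<alpha> *\<^sub>R X n" for n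
    unfolding op_poly_def poly_altdef
    by (simp add: scaleR_diff_right sum_subtractf scaleR_sum_left)
  ultimately show ?thesis by (simp only:) simp
qed

lemma norm_tendsto_of_approximate_eigenvector:
  fixes X :: "nat \<Rightarrow> 'a::real_normed_vector"
  assumes "\<And>n. norm (X n) = 1" "(\<lambda>n. u n - c *\<^sub>R X n) \<longlonglongrightarrow> 0"
  shows "(\<lambda>n. norm (u n)) \<longlonglongrightarrow> \<bar>c\<bar>"
proof -
  have "(\<lambda>n. norm (u n) - norm (c *\<^sub>R X n)) \<longlonglongrightarrow> 0"
    by (rule Lim_null_comparison[OF always_eventually tendsto_norm_zero[OF assms(2)]])
       (simp only: real_norm_def norm_triangle_ineq3 simp_thms)
  then show ?thesis using assms(1) by (simp add: LIM_zero_iff)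
qed

text \<open>
  Because \<open>Q\<close> is nonnegative, \<open>\<parallel>S* y\<parallel> \<le> \<parallel>T* y\<parallel>\<close>. Tested against the dense set of vectors \<open>T* y\<close>,
  the vector \<open>u\<close> satisfies \<open>[u, T* y] = [S S* T x, y] = [S* T x, S* y]\<close>, which is at most
  \<open>\<parallel>T* T x\<parallel> \<parallel>T* y\<parallel>\<close> in absolute value; and \<open>T* T x = u + w\<close> since \<open>T\<close> is injective.
\<close>

lemma norm_le_of_nonneg_summand:
  fixes T :: "'v::complex_hilbert_space \<Rightarrow> 'k::krein_space"
    and S :: "'w::complex_hilbert_space \<Rightarrow> 'k"
  assumes T: "bounded_clinear T" and inj: "inj T" and S: "bounded_clinear S"
    and SS: "\<And>x. S (adj S x) = P x" and TT: "\<And>x. T (adj T x) = P x + Q x"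
    and Q: "nonneg_op Q"
    and u: "T u = P (T x)" and w: "T w = Q (T x)"
  shows "norm u \<le> norm (u + w)"
proof -
  have contr: "norm (adj S y) \<le> norm (adj T y)" for y
  proof -
    have "0 \<le> Re (ip (Q y) y)" using Q unfolding nonneg_op_def by (auto simp: complex_nonneg_Reals_iff)
    moreover have "(norm (adj S y))\<^sup>2 = Re (ip (P y) y)"
      unfolding SS[symmetric] ip_adj_left[OF S, symmetric] ip_TT_adj[OF S] Re_ip_self ..
    moreover have "(norm (adj T y))\<^sup>2 = Re (ip (P y + Q y) y)"
      unfolding TT[symmetric] ip_TT_adj[OF T] Re_ip_self ..
    ultimately have "(norm (adj S y))\<^sup>2 \<le> (norm (adj T y))\<^sup>2" by (simp add: ip.form_simps)
    then show ?thesis by (rule power2_le_imp_le) simp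
  qed
  have uw: "adj T (T x) = u + w"
    by (rule injD[OF inj]) (simp add: TT u w bounded_clinearD[OF T])
  have bound: "cmod (ip u (adj T y)) \<le> norm (u + w) * norm (adj T y)" for y
  proof -
    have "ip u (adj T y) = ip (adj S (T x)) (adj S y)"
      unfolding ip_adj_right[OF T, symmetric] u SS[symmetric] ip_TT_adj[OF S] ..
    then have "cmod (ip u (adj T y)) \<le> norm (adj S (T x)) * norm (adj S y)"
      by (simp only: cmod_ip_le)
    also have "\<dots> \<le> norm (adj T (T x)) * norm (adj T y)"
      by (intro mult_mono contr) auto
    finally show ?thesis unfolding uw .
  qed
  have "u \<in> closure (range (adj T))" using dense_range_adj[OF T inj] by simp
  then obtain X where X: "\<forall>n. X n \<in> range (adj T)" "X \<longlonglongrightarrow> u"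
    unfolding closure_sequential by blast
  have "(\<lambda>n. ip u (X n - u)) \<longlonglongrightarrow> 0"
  proof (rule Lim_null_comparison[OF always_eventually])
    show "\<forall>n. cmod (ip u (X n - u)) \<le> norm u * norm (X n - u)" by (simp add: cmod_ip_le)
    have "(\<lambda>n. norm u * norm (X n - u)) \<longlonglongrightarrow> norm u * norm (u - u)"
      by (intro tendsto_intros X)
    then show "(\<lambda>n. norm u * norm (X n - u)) \<longlonglongrightarrow> 0" by simp
  qed
  then have "(\<lambda>n. ip u (X n)) \<longlonglongrightarrow> ip u u"
    by (simp add: ip.form_simps LIM_zero_iff)
  then have "(\<lambda>n. cmod (ip u (X n))) \<longlonglongrightarrow> cmod (ip u u)" by (rule tendsto_norm)
  moreover have "(\<lambda>n. norm (u + w) * norm (X n)) \<longlonglongrightarrow> norm (u + w) * norm u"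
    by (intro tendsto_intros X)
  moreover have "cmod (ip u (X n)) \<le> norm (u + w) * norm (X n)" for n
    using X(1) bound by (metis rangeE)
  ultimately have "cmod (ip u u) \<le> norm (u + w) * norm u" by (intro LIMSEQ_le) auto
  then have "norm u * norm u \<le> norm (u + w) * norm u"
    using norm_sq_le_ip[of u] by (simp add: power2_eq_square)
  then show ?thesis by (cases "u = 0") auto
qed

text \<open>
  Let \<open>D = Theta T N\<close> have real part \<open>a\<close> and imaginary part \<open>b\<close>. Nonnegativity of \<open>q(B)\<close> gives
  \<open>\<parallel>p(a) x\<parallel> \<le> \<parallel>p(a) x + q(b) x\<parallel>\<close>, and that of \<open>p(A)\<close> gives the same bound for \<open>q(b) x\<close>. On
  approximate eigenvectors of \<open>D\<close> for \<open>z\<close> these norms converge to the numbers in the claim. Thus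
  \<open>p(Re z)\<close> and \<open>q(Im z)\<close> do not cancel on the spectrum.
\<close>

theorem spectrum_Theta:
  fixes N :: "'k::krein_space \<Rightarrow> 'k"
    and T1 :: "'v1::complex_hilbert_space \<Rightarrow> 'k"
    and T2 :: "'v2::complex_hilbert_space \<Rightarrow> 'k"
    and T :: "'v::complex_hilbert_space \<Rightarrow> 'k"
  assumes normal: "normal_op N"
    and p: "nonneg_op (op_poly p (real_part N))" and q: "nonneg_op (op_poly q (imag_part N))"
    and T1: "bounded_clinear T1" and TT1: "T1 \<circ> adj T1 = op_poly p (real_part N)"
    and T2: "bounded_clinear T2" and TT2: "T2 \<circ> adj T2 = op_poly q (imag_part N)"
    and T: "bounded_clinear T" and inj: "inj T"
    and TT: "T \<circ> adj T = (\<lambda>x. op_poly p (real_part N) x + op_poly q (imag_part N) x)"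
  shows "compact (op_spectrum (Theta T N))"
    and "\<And>z. z \<in> op_spectrum (Theta T N) \<Longrightarrow>
      max \<bar>poly p (Re z)\<bar> \<bar>poly q (Im z)\<bar> \<le> \<bar>poly p (Re z) + poly q (Im z)\<bar>"
proof -
  have N: "bounded_clinear N" using normal unfolding normal_op_def by blast
  have NN: "N (adj N x) = adj N (N x)" for x
    using normal unfolding normal_op_def by (auto simp: fun_eq_iff)
  note N' = bounded_clinear_adj[OF N]
  note lin = bounded_clinearD[OF N] and lin' = bounded_clinearD[OF N'] and Tlin = bounded_clinearD[OF T]
  let ?P = "op_poly p (real_part N)" and ?Q = "op_poly q (imag_part N)"
  have TT': "T (adj T x) = ?P x + ?Q x" for x using TT by (auto simp: fun_eq_iff)
  have comm: "N (T (adj T x)) = T (adj T (N x))" for x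
  proof -
    have "N (real_part N x) = real_part N (N x)" "N (imag_part N x) = imag_part N (N x)" for x
      unfolding real_part_def imag_part_def by (simp_all add: lin NN)
    then show ?thesis unfolding TT' lin(3) by (simp add: op_poly_intertwine[OF lin(1)])
  qed
  define D where "D = Theta T N"
  note comm' = adj_commutes_TT_adj[OF T N comm]
  have TD: "T (D x) = N (T x)" for x unfolding D_def by (rule T_Theta[OF T inj N comm])
  have D: "bounded_clinear D" unfolding D_def by (rule bounded_clinear_Theta[OF T inj N comm])
  have TD': "T (adj D x) = adj N (T x)" for x
    unfolding D_def adj_Theta[OF T inj N comm] by (rule T_Theta[OF T inj N' comm'])
  have D': "bounded_clinear (adj D)" by (rule bounded_clinear_adj[OF D])
  have "D (adj D x) = adj D (D x)" for x by (rule injD[OF inj]) (simp add: TD TD' NN)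
  then have normal_D: "normal_op D" unfolding normal_op_def using D by (auto simp: fun_eq_iff)
  show "compact (op_spectrum (Theta T N))"
    using compact_op_spectrum[OF normal_D] unfolding D_def .
  let ?a = "real_part D" and ?b = "imag_part D"
  have T_ab: "T (?a x) = real_part N (T x)" "T (?b x) = imag_part N (T x)" for x
    unfolding real_part_def imag_part_def by (simp_all add: Tlin TD TD')
  have inter: "T (op_poly p ?a x) = ?P (T x)" "T (op_poly q ?b x) = ?Q (T x)" for x
    by (rule op_poly_intertwine[OF Tlin(1)], rule T_ab)+
  have a: "bounded_linear ?a" and b: "bounded_linear ?b"
    unfolding real_part_def imag_part_def
    by (intro bounded_clinearD(1) bounded_clinear_compose[OF bounded_clinear_scaleC_const]
        bounded_clinear_add bounded_clinear_diff D D')+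
  have le_p: "norm (op_poly p ?a x) \<le> norm (op_poly p ?a x + op_poly q ?b x)" for x
    using TT1 by (intro norm_le_of_nonneg_summand[OF T inj T1 _ TT' q]) (auto simp: inter fun_eq_iff)
  have TT'': "T (adj T x) = ?Q x + ?P x" for x unfolding TT' by (rule add.commute)
  have le_q: "norm (op_poly q ?b x) \<le> norm (op_poly p ?a x + op_poly q ?b x)" for x
    unfolding add.commute[of "op_poly p ?a x"]
    using TT2 by (intro norm_le_of_nonneg_summand[OF T inj T2 _ TT'' p]) (auto simp: inter fun_eq_iff)
  fix z assume "z \<in> op_spectrum (Theta T N)"
  then have "z \<in> op_spectrum D" by (simp add: D_def)
  then obtain X where X: "\<And>n::nat. norm (X n) = 1" "(\<lambda>n. D (X n) - z *\<^sub>C X n) \<longlonglongrightarrow> 0"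
    "(\<lambda>n. adj D (X n) - cnj z *\<^sub>C X n) \<longlonglongrightarrow> 0"
    by (rule approximate_eigenvectors[OF normal_D]) (rule that)
  have lim_scale: "(\<lambda>n. c *\<^sub>C (U n :: 'v)) \<longlonglongrightarrow> 0" if "U \<longlonglongrightarrow> 0" for c U
    using bounded_linear.tendsto[OF bounded_clinearD(1)[OF bounded_clinear_scaleC_const] that, of c] by simp
  have "?a x - Re z *\<^sub>R x = (1/2) *\<^sub>C ((D x - z *\<^sub>C x) + (adj D x - cnj z *\<^sub>C x))" for x
  proof -
    have "Re z *\<^sub>R x = (1/2) *\<^sub>C (z *\<^sub>C x + cnj z *\<^sub>C x)"
      unfolding scaleR_scaleC scaleC_add_left[symmetric] scaleC_scaleC complex_add_cnj by simp
    then show ?thesis by (simp add: real_part_def scaleC_add_right scaleC_diff_right)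
  qed
  then have "(\<lambda>n. ?a (X n) - Re z *\<^sub>R X n) \<longlonglongrightarrow> 0"
    using lim_scale[OF tendsto_add_zero[OF X(2,3)]] by simp
  note lim_a = op_poly_approximate_eigenvector[OF a this]
  have "?b x - Im z *\<^sub>R x = (1/(2*\<i>)) *\<^sub>C ((D x - z *\<^sub>C x) - (adj D x - cnj z *\<^sub>C x))" for x
  proof -
    have "1 / (2 * \<i>) * (z - cnj z) = of_real (Im z)" by (simp add: complex_eq_iff)
    then have "Im z *\<^sub>R x = (1/(2*\<i>)) *\<^sub>C (z *\<^sub>C x - cnj z *\<^sub>C x)"
      unfolding scaleR_scaleC scaleC_diff_left[symmetric] scaleC_scaleC by (simp only:)
    then show ?thesis by (simp add: imag_part_def scaleC_diff_right)
  qed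
  then have "(\<lambda>n. ?b (X n) - Im z *\<^sub>R X n) \<longlonglongrightarrow> 0"
    using lim_scale[OF tendsto_diff[OF X(2,3), unfolded diff_zero]] by simp
  note lim_b = op_poly_approximate_eigenvector[OF b this]
  have "(\<lambda>n. (op_poly p ?a (X n) + op_poly q ?b (X n)) - (poly p (Re z) + poly q (Im z)) *\<^sub>R X n) \<longlonglongrightarrow> 0"
    using tendsto_add_zero[OF lim_a[of p] lim_b[of q]] by (simp add: algebra_simps)
  note lim_ab = norm_tendsto_of_approximate_eigenvector[OF X(1) this]
  have "\<bar>poly p (Re z)\<bar> \<le> \<bar>poly p (Re z) + poly q (Im z)\<bar>"
    using norm_tendsto_of_approximate_eigenvector[OF X(1) lim_a[of p]] lim_ab
    by (rule LIMSEQ_le) (use le_p in blast)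
  moreover have "\<bar>poly q (Im z)\<bar> \<le> \<bar>poly p (Re z) + poly q (Im z)\<bar>"
    using norm_tendsto_of_approximate_eigenvector[OF X(1) lim_b[of q]] lim_ab
    by (rule LIMSEQ_le) (use le_q in blast)
  ultimately show "max \<bar>poly p (Re z)\<bar> \<bar>poly q (Im z)\<bar> \<le> \<bar>poly p (Re z) + poly q (Im z)\<bar>" by simp
qed

section \<open>Taylor coefficients and Hermite interpolation\<close>

definition taylor :: "complex poly \<Rightarrow> nat \<Rightarrow> complex \<Rightarrow> complex" where
  "taylor a k \<xi> = coeff (a \<circ>\<^sub>p [:\<xi>, 1:]) k"

text \<open>
  Taylor coefficients are the coefficients of the shifted polynomial; this makes products and
  divisibility by powers of \<open>X - \<xi>\<close> accessible without the Leibniz rule.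
\<close>

lemma poly_higher_pderiv: "poly ((pderiv ^^ k) a) \<xi> = fact k * taylor a k \<xi>"
proof -
  have shift: "(pderiv ^^ k) (a \<circ>\<^sub>p [:\<xi>, 1:]) = (pderiv ^^ k) a \<circ>\<^sub>p [:\<xi>, 1:]"
    by (induction k) (simp_all add: pderiv_pcompose pderiv_pCons)
  have "poly ((pderiv ^^ k) a) \<xi> = coeff ((pderiv ^^ k) (a \<circ>\<^sub>p [:\<xi>, 1:])) 0"
    unfolding shift by (simp add: poly_0_coeff_0[symmetric] poly_pcompose)
  then show ?thesis
    by (simp add: coeff_higher_pderiv taylor_def pochhammer_fact[symmetric])
qed

lemma taylor_expansion:
  "\<exists>r. \<forall>x. poly a x = (\<Sum>k<m. taylor a k \<xi> * (x - \<xi>) ^ k) + (x - \<xi>) ^ m * poly r x"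
proof -
  define b where "b = a \<circ>\<^sub>p [:\<xi>, 1:]"
  have cutoff: "(\<Sum>k<m. monom (coeff b k) k) + monom 1 m * poly_shift m b = b"
    by (rule poly_eqI) (auto simp: coeff_sum coeff_monom_mult coeff_poly_shift)
  have "poly a x = (\<Sum>k<m. taylor a k \<xi> * (x - \<xi>) ^ k)
      + (x - \<xi>) ^ m * poly (poly_shift m b \<circ>\<^sub>p [:- \<xi>, 1:]) x" for x
  proof -
    have "poly a x = poly b (x - \<xi>)" by (simp add: b_def poly_pcompose)
    also have "\<dots> = poly ((\<Sum>k<m. monom (coeff b k) k) + monom 1 m * poly_shift m b) (x - \<xi>)"
      unfolding cutoff ..
    finally show ?thesis
      by (simp add: poly_pcompose taylor_def poly_sum poly_monom b_def[symmetric])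
  qed
  then show ?thesis by blast
qed

lemma taylor_factor_power:
  "taylor ([:- \<xi>, 1:] ^ m * r) k \<xi> = (if k < m then 0 else taylor r (k - m) \<xi>)"
proof -
  have "[:- \<xi>, 1:] \<circ>\<^sub>p [:\<xi>, 1:] = monom 1 1" by (simp add: pcompose_pCons monom_altdef)
  then have "[:- \<xi>, 1:] ^ m \<circ>\<^sub>p [:\<xi>, 1:] = monom 1 m"
    by (induction m) (simp_all only: power_Suc power_0 pcompose_mult pcompose_1 mult_monom, simp_all add: monom_altdef)
  then have "([:- \<xi>, 1:] ^ m * r) \<circ>\<^sub>p [:\<xi>, 1:] = monom 1 m * (r \<circ>\<^sub>p [:\<xi>, 1:])"
    by (simp only: pcompose_mult)
  then show ?thesis by (simp add: taylor_def coeff_monom_mult)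
qed

lemma taylor_0: "taylor a 0 \<xi> = poly a \<xi>"
  using poly_higher_pderiv[of 0 a \<xi>] by simp

lemma taylor_diff: "taylor (a - b) k \<xi> = taylor a k \<xi> - taylor b k \<xi>"
  by (simp add: taylor_def pcompose_diff)

lemma taylor_smult: "taylor (smult c a) k \<xi> = c * taylor a k \<xi>"
  by (simp add: taylor_def pcompose_smult)

lemma taylor_one: "taylor 1 k \<xi> = (if k = 0 then 1 else 0)"
  by (simp add: taylor_def pcompose_1 coeff_1)

lemma taylor_order_nonzero:
  assumes "P \<noteq> 0"
  shows "taylor P (order \<xi> P) \<xi> \<noteq> 0"
proof -
  obtain r where r: "P = [:- \<xi>, 1:] ^ order \<xi> P * r" "\<not> [:- \<xi>, 1:] dvd r"
    using order_decomp[OF assms] by blast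
  have "taylor P (order \<xi> P) \<xi> = poly r \<xi>"
    by (subst r(1)) (simp add: taylor_factor_power taylor_0)
  then show ?thesis using r(2) by (simp add: poly_eq_0_iff_dvd)
qed

text \<open>
  Write \<open>P = (X - \<xi>)^m Q\<close> with \<open>c = Q(\<xi>) \<noteq> 0\<close> and \<open>R = 1 - Q / c\<close>. Then \<open>X - \<xi>\<close> divides \<open>R\<close>, so
  \<open>1 - R^m\<close> is \<open>1\<close> modulo \<open>(X - \<xi>)^m\<close>; it is a multiple of \<open>Q\<close>, because \<open>1 - R\<close> is, and so
  vanishes at the other zeros of \<open>P\<close> to the order of \<open>P\<close>. Hence \<open>(X - \<xi>)^k (1 - R^m)\<close> has the
  required coefficients.
\<close>

lemma taylor_dual_basis:
  assumes P: "P \<noteq> 0" and k: "k < order \<xi> P"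
  shows "\<exists>a. \<forall>\<zeta> j. j < order \<zeta> P \<longrightarrow> taylor a j \<zeta> = (if \<zeta> = \<xi> \<and> j = k then 1 else 0)"
proof -
  let ?m = "order \<xi> P"
  obtain Q where Q: "P = [:- \<xi>, 1:] ^ ?m * Q" "\<not> [:- \<xi>, 1:] dvd Q"
    using order_decomp[OF P] by blast
  define c where "c = poly Q \<xi>"
  have c: "c \<noteq> 0" using Q(2) by (simp add: c_def poly_eq_0_iff_dvd)
  define R where "R = 1 - smult (1 / c) Q"
  define a where "a = [:- \<xi>, 1:] ^ k * (1 - R ^ ?m)"
  have "[:- \<xi>, 1:] dvd R"
    using c by (simp add: R_def poly_eq_0_iff_dvd[symmetric] c_def)
  then have "[:- \<xi>, 1:] ^ ?m dvd R ^ ?m" by (rule dvd_power_same)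
  then obtain R' where R': "R ^ ?m = [:- \<xi>, 1:] ^ ?m * R'" by (rule dvdE)
  have "Q dvd 1 - R ^ ?m"
  proof -
    have "1 - R dvd 1 ^ ?m - R ^ ?m" unfolding power_diff_sumr2 by (rule dvd_triv_left)
    moreover have "Q dvd 1 - R" by (simp add: R_def dvd_smult)
    ultimately show ?thesis unfolding power_one by (rule dvd_trans[rotated])
  qed
  then obtain Q' where Q': "1 - R ^ ?m = Q * Q'" by (rule dvdE)
  have "taylor a j \<xi> = (if j = k then 1 else 0)" if "j < ?m" for j
  proof -
    have "a = [:- \<xi>, 1:] ^ k * 1 - [:- \<xi>, 1:] ^ ?m * ([:- \<xi>, 1:] ^ k * R')"
      by (simp add: a_def R' algebra_simps)
    then show ?thesis using that
      by (simp add: taylor_diff taylor_factor_power taylor_one del: mult_1_right)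
  qed
  note at_root = this
  have "taylor a j \<zeta> = 0" if "j < order \<zeta> P" "\<zeta> \<noteq> \<xi>" for j \<zeta>
  proof -
    have "order \<zeta> P = order \<zeta> ([:- \<xi>, 1:] ^ ?m) + order \<zeta> Q"
      using P Q(1) by (metis order_mult)
    also have "order \<zeta> ([:- \<xi>, 1:] ^ ?m) = 0"
      using that(2) by (intro order_0I) (simp add: poly_power)
    finally have "[:- \<zeta>, 1:] ^ order \<zeta> P dvd Q" using order_1[of \<zeta> Q] by simp
    then have "[:- \<zeta>, 1:] ^ order \<zeta> P dvd a" by (simp add: a_def Q')
    then obtain r where "a = [:- \<zeta>, 1:] ^ order \<zeta> P * r" by (rule dvdE)
    then show ?thesis using that(1) by (simp add: taylor_factor_power)
  qed
  note elsewhere = this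
  have "taylor a j \<zeta> = (if \<zeta> = \<xi> \<and> j = k then 1 else 0)" if "j < order \<zeta> P" for \<zeta> j
    using that at_root elsewhere by (cases "\<zeta> = \<xi>") simp_all
  then show ?thesis by blast
qed

text \<open>
  The polynomial \<open>a(z) b(w)\<close>. These span all polynomials in two variables, and their Taylor
  coefficients factor.
\<close>

definition tensor :: "complex poly \<Rightarrow> complex poly \<Rightarrow> complex poly poly" where
  "tensor a b = map_poly (\<lambda>c. smult c a) b"

lemma coeff_tensor: "coeff (tensor a b) l = smult (coeff b l) a"
  by (simp add: tensor_def coeff_map_poly)

lemma poly_zw_tensor: "poly_zw (tensor a b) z w = poly a z * poly b w"
proof (induction b)
  case 0
  then show ?case by (simp add: poly_zw_def tensor_def)
next
  case (pCons c b)
  have "tensor a (pCons c b) = pCons (smult c a) (tensor a b)"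
    by (rule poly_eqI) (simp add: coeff_tensor coeff_pCons split: nat.split)
  then show ?case using pCons.IH by (simp add: poly_zw_def algebra_simps)
qed

lemma taylor_coeff_tensor:
  "taylor_coeff (tensor a b) k l \<xi> \<eta> = taylor a k \<xi> * taylor b l \<eta>"
proof -
  have "pderiv (tensor a b) = tensor a (pderiv b)" for a b
    by (rule poly_eqI) (simp add: coeff_tensor coeff_pderiv of_nat_poly mult.commute)
  then have w: "(pderiv ^^ l) (tensor a b) = tensor a ((pderiv ^^ l) b)" for b
    by (induction l) simp_all
  have "map_poly pderiv (tensor a b) = tensor (pderiv a) b" for a b
    by (rule poly_eqI) (simp add: coeff_tensor coeff_map_poly pderiv_smult)
  then have z: "(map_poly pderiv ^^ k) (tensor a b) = tensor ((pderiv ^^ k) a) b" for b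
    by (induction k) simp_all
  show ?thesis
    unfolding taylor_coeff_def w z poly_zw_tensor poly_higher_pderiv by simp
qed

lemma poly_zw_sum: "poly_zw (sum f A) z w = (\<Sum>i\<in>A. poly_zw (f i) z w)"
  by (simp add: poly_zw_def poly_sum)

lemma taylor_coeff_sum:
  "taylor_coeff (sum f A) k l \<xi> \<eta> = (\<Sum>i\<in>A. taylor_coeff (f i) k l \<xi> \<eta>)"
proof -
  have add: "map_poly pderiv (s + t) = map_poly pderiv s + map_poly pderiv (t :: complex poly poly)" for s t
    by (rule poly_eqI) (simp add: coeff_map_poly pderiv_add)
  have "map_poly pderiv (sum f A) = (\<Sum>i\<in>A. map_poly pderiv (f i))" for f :: "'a \<Rightarrow> complex poly poly"
    by (induction A rule: infinite_finite_induct) (simp_all add: add)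
  then have "(map_poly pderiv ^^ k) (sum f A) = (\<Sum>i\<in>A. (map_poly pderiv ^^ k) (f i))"
    for f :: "'a \<Rightarrow> complex poly poly"
    by (induction k) simp_all
  then show ?thesis
    by (simp add: taylor_coeff_def higher_pderiv_sum poly_zw_sum sum_divide_distrib)
qed

lemma sum_tensor_monom: "(\<Sum>i\<le>degree s. tensor (coeff s i) (monom 1 i)) = s"
proof -
  have "tensor (coeff s i) (monom 1 i) = monom (coeff s i) i" for i
    by (rule poly_eqI) (simp add: coeff_tensor)
  then show ?thesis by (simp add: poly_as_sum_of_monoms)
qed

text \<open>
  Tensor products of the dual bases of \<open>P\<close> and \<open>Q\<close> form a dual basis for the jets on the grid of
  pairs of zeros.
\<close>

lemma hermite_interpolation:
  assumes P: "P \<noteq> 0" and Q: "Q \<noteq> 0"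
  shows "\<exists>s. \<forall>\<xi> \<eta> k l. k < order \<xi> P \<longrightarrow> l < order \<eta> Q \<longrightarrow> taylor_coeff s k l \<xi> \<eta> = f \<xi> \<eta> k l"
proof -
  have basis: "\<exists>e. \<forall>\<xi> k. k < order \<xi> P \<longrightarrow>
      (\<forall>\<zeta> j. j < order \<zeta> P \<longrightarrow> taylor (e (\<xi>, k)) j \<zeta> = (if \<zeta> = \<xi> \<and> j = k then 1 else 0))"
    if "P \<noteq> 0" for P
  proof -
    have "\<forall>i. \<exists>a. snd i < order (fst i) P \<longrightarrow>
      (\<forall>\<zeta> j. j < order \<zeta> P \<longrightarrow> taylor a j \<zeta> = (if \<zeta> = fst i \<and> j = snd i then 1 else 0))"
      using taylor_dual_basis[OF that] by blast
    from choice[OF this] show ?thesis by (elim exE, intro exI) auto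
  qed
  obtain a where a: "\<And>\<xi> k \<zeta> j. k < order \<xi> P \<Longrightarrow> j < order \<zeta> P \<Longrightarrow>
      taylor (a (\<xi>, k)) j \<zeta> = (if \<zeta> = \<xi> \<and> j = k then 1 else 0)"
    using basis[OF P] by blast
  obtain b where b: "\<And>\<eta> l \<zeta> j. l < order \<eta> Q \<Longrightarrow> j < order \<zeta> Q \<Longrightarrow>
      taylor (b (\<eta>, l)) j \<zeta> = (if \<zeta> = \<eta> \<and> j = l then 1 else 0)"
    using basis[OF Q] by blast
  define A where "A = (SIGMA \<xi>:{\<xi>. poly P \<xi> = 0}. {..<order \<xi> P})"
  define B where "B = (SIGMA \<eta>:{\<eta>. poly Q \<eta> = 0}. {..<order \<eta> Q})"
  have fin: "finite A" "finite B"
    unfolding A_def B_def using poly_roots_finite[OF P] poly_roots_finite[OF Q] by auto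
  have memA: "(\<xi>, k) \<in> A \<longleftrightarrow> k < order \<xi> P" for \<xi> k
    using P by (auto simp: A_def order_root)
  have memB: "(\<eta>, l) \<in> B \<longleftrightarrow> l < order \<eta> Q" for \<eta> l
    using Q by (auto simp: B_def order_root)
  define s where "s = (\<Sum>(i, j)\<in>A \<times> B.
      tensor (smult (f (fst i) (fst j) (snd i) (snd j)) (a i)) (b j))"
  have "taylor_coeff s k l \<xi> \<eta> = f \<xi> \<eta> k l" if kl: "k < order \<xi> P" "l < order \<eta> Q" for \<xi> \<eta> k l
  proof -
    have "taylor_coeff s k l \<xi> \<eta> = (\<Sum>x\<in>A \<times> B. if x = ((\<xi>, k), (\<eta>, l)) then f \<xi> \<eta> k l else 0)"
      unfolding s_def taylor_coeff_sum
    proof (rule sum.cong[OF refl])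
      fix x assume x: "x \<in> A \<times> B"
      obtain \<xi>' k' \<eta>' l' where x_eq: "x = ((\<xi>', k'), (\<eta>', l'))" by (metis prod.exhaust)
      have "k' < order \<xi>' P" "l' < order \<eta>' Q" using x by (auto simp: x_eq memA memB)
      then show "taylor_coeff (case x of (i, j) \<Rightarrow> tensor (smult (f (fst i) (fst j) (snd i) (snd j)) (a i)) (b j)) k l \<xi> \<eta>
          = (if x = ((\<xi>, k), (\<eta>, l)) then f \<xi> \<eta> k l else 0)"
        using kl by (auto simp: x_eq taylor_coeff_tensor taylor_smult a b)
    qed
    also have "\<dots> = f \<xi> \<eta> k l"
      using kl fin by (simp add: memA memB)
    finally show ?thesis .
  qed
  then show ?thesis by blast
qed

lemma poly_bounded_near:
  fixes r :: "complex poly"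
  obtains B where "B \<ge> 0" "\<And>x. cmod (x - \<xi>) \<le> 1 \<Longrightarrow> cmod (poly r x) \<le> B"
proof -
  have "compact (poly r ` cball \<xi> 1)"
    by (intro compact_continuous_image continuous_intros compact_cball)
  then obtain B where B: "\<forall>y\<in>poly r ` cball \<xi> 1. cmod y \<le> B"
    using compact_imp_bounded bounded_iff by blast
  then have "cmod (poly r x) \<le> \<bar>B\<bar>" if "cmod (x - \<xi>) \<le> 1" for x
    using that by (force simp: dist_norm norm_minus_commute)
  then show thesis using that[of "\<bar>B\<bar>"] by simp
qed

text \<open>
  For a product \<open>a(z) b(w)\<close>, replacing first \<open>a\<close> and then \<open>b\<close> by its Taylor polynomial leaves
  errors with the factors \<open>(z - \<xi>)^m\<close> and \<open>(w - \<eta>)^n\<close>. Sums of products give the general case.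
\<close>

lemma taylor_remainder:
  "\<exists>C. \<forall>z w. cmod (z - \<xi>) \<le> 1 \<longrightarrow> cmod (w - \<eta>) \<le> 1 \<longrightarrow>
    cmod (poly_zw s z w - (\<Sum>k<m. \<Sum>l<n. taylor_coeff s k l \<xi> \<eta> * (z - \<xi>) ^ k * (w - \<eta>) ^ l))
      \<le> C * max (cmod (z - \<xi>) ^ m) (cmod (w - \<eta>) ^ n)"
proof -
  define R where "R = (\<lambda>s z w. poly_zw s z w
    - (\<Sum>k<m. \<Sum>l<n. taylor_coeff s k l \<xi> \<eta> * (z - \<xi>) ^ k * (w - \<eta>) ^ l))"
  define M where "M = (\<lambda>z w. max (cmod (z - \<xi>) ^ m) (cmod (w - \<eta>) ^ n))"
  have tensor_bound: "\<exists>C. \<forall>z w. cmod (z - \<xi>) \<le> 1 \<longrightarrow> cmod (w - \<eta>) \<le> 1 \<longrightarrow>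
      cmod (R (tensor a b) z w) \<le> C * M z w" for a b
  proof -
    obtain ra where ra: "\<And>x. poly a x = (\<Sum>k<m. taylor a k \<xi> * (x - \<xi>) ^ k) + (x - \<xi>) ^ m * poly ra x"
      using taylor_expansion[where a = a and m = m and \<xi> = \<xi>] by blast
    obtain rb where rb: "\<And>x. poly b x = (\<Sum>k<n. taylor b k \<eta> * (x - \<eta>) ^ k) + (x - \<eta>) ^ n * poly rb x"
      using taylor_expansion[where a = b and m = n and \<xi> = \<eta>] by blast
    define ta where "ta = a - [:- \<xi>, 1:] ^ m * ra"
    have ta: "poly ta z = (\<Sum>k<m. taylor a k \<xi> * (z - \<xi>) ^ k)" for z
      by (simp add: ta_def ra poly_power)
    obtain A where A: "A \<ge> 0" "\<And>x. cmod (x - \<xi>) \<le> 1 \<Longrightarrow> cmod (poly ta x) \<le> A"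
      by (rule poly_bounded_near[of \<xi>]) (rule that)
    obtain B where B: "B \<ge> 0" "\<And>x. cmod (x - \<eta>) \<le> 1 \<Longrightarrow> cmod (poly b x) \<le> B"
      by (rule poly_bounded_near[of \<eta>]) (rule that)
    obtain A' where A': "A' \<ge> 0" "\<And>x. cmod (x - \<xi>) \<le> 1 \<Longrightarrow> cmod (poly ra x) \<le> A'"
      by (rule poly_bounded_near[of \<xi>]) (rule that)
    obtain B' where B': "B' \<ge> 0" "\<And>x. cmod (x - \<eta>) \<le> 1 \<Longrightarrow> cmod (poly rb x) \<le> B'"
      by (rule poly_bounded_near[of \<eta>]) (rule that)
    have "cmod (R (tensor a b) z w) \<le> (A' * B + A * B') * M z w"
      if z: "cmod (z - \<xi>) \<le> 1" and w: "cmod (w - \<eta>) \<le> 1" for z w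
    proof -
      have "R (tensor a b) z w = poly a z * poly b w - poly ta z * (\<Sum>l<n. taylor b l \<eta> * (w - \<eta>) ^ l)"
        by (simp add: R_def poly_zw_tensor taylor_coeff_tensor ta sum_product mult_ac)
      also have "\<dots> = (z - \<xi>) ^ m * (poly ra z * poly b w) + (w - \<eta>) ^ n * (poly ta z * poly rb w)"
        using ra[of z] rb[of w] by (simp add: ta algebra_simps)
      finally have "cmod (R (tensor a b) z w) \<le>
          cmod ((z - \<xi>) ^ m) * (cmod (poly ra z) * cmod (poly b w))
          + cmod ((w - \<eta>) ^ n) * (cmod (poly ta z) * cmod (poly rb w))"
        by (metis norm_mult norm_triangle_ineq)
      also have "\<dots> \<le> M z w * (A' * B) + M z w * (A * B')"
        by (intro add_mono mult_mono A(2)[OF z] B(2)[OF w] A'(2)[OF z] B'(2)[OF w])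
           (auto simp: M_def norm_power A(1) B(1) A'(1) B'(1) le_max_iff_disj)
      finally show ?thesis by (simp add: algebra_simps)
    qed
    then show ?thesis by blast
  qed
  have "\<forall>i. \<exists>C. \<forall>z w. cmod (z - \<xi>) \<le> 1 \<longrightarrow> cmod (w - \<eta>) \<le> 1 \<longrightarrow>
      cmod (R (tensor (coeff s i) (monom 1 i)) z w) \<le> C * M z w"
    using tensor_bound by blast
  from choice[OF this] obtain C where C: "\<And>i z w. cmod (z - \<xi>) \<le> 1 \<Longrightarrow> cmod (w - \<eta>) \<le> 1 \<Longrightarrow>
      cmod (R (tensor (coeff s i) (monom 1 i)) z w) \<le> C i * M z w"
    by blast
  have R_sum: "R (sum f A) z w = (\<Sum>i\<in>A. R (f i) z w)" for f z w and A :: "nat set"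
  proof -
    have "(\<Sum>k<m. \<Sum>l<n. (\<Sum>i\<in>A. taylor_coeff (f i) k l \<xi> \<eta>) * (z - \<xi>) ^ k * (w - \<eta>) ^ l)
      = (\<Sum>i\<in>A. \<Sum>k<m. \<Sum>l<n. taylor_coeff (f i) k l \<xi> \<eta> * (z - \<xi>) ^ k * (w - \<eta>) ^ l)"
      unfolding sum_distrib_right by (subst sum.swap, subst (2) sum.swap) (rule refl)
    then show ?thesis
      by (simp add: R_def poly_zw_sum taylor_coeff_sum sum_subtractf)
  qed
  have "cmod (R s z w) \<le> (\<Sum>i\<le>degree s. C i) * M z w"
    if "cmod (z - \<xi>) \<le> 1" "cmod (w - \<eta>) \<le> 1" for z w
  proof -
    have "R s z w = (\<Sum>i\<le>degree s. R (tensor (coeff s i) (monom 1 i)) z w)"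
      unfolding R_sum[symmetric] sum_tensor_monom ..
    also have "cmod \<dots> \<le> (\<Sum>i\<le>degree s. C i * M z w)"
      by (rule sum_norm_le) (rule C[OF that])
    finally show ?thesis by (simp add: sum_distrib_right)
  qed
  then show ?thesis unfolding R_def M_def by blast
qed

text \<open>
  Split off the factor \<open>(X - \<xi>)^m\<close>; the cofactor is bounded away from zero near \<open>\<xi>\<close>.
\<close>

lemma poly_lower_bound:
  fixes P :: "complex poly"
  assumes "P \<noteq> 0"
  obtains c e where "c > 0" "e > 0"
    "\<And>x. cmod (x - \<xi>) < e \<Longrightarrow> c * cmod (x - \<xi>) ^ order \<xi> P \<le> cmod (poly P x)"
proof -
  obtain r where r: "P = [:- \<xi>, 1:] ^ order \<xi> P * r" "\<not> [:- \<xi>, 1:] dvd r"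
    using order_decomp[OF assms] by blast
  define c where "c = cmod (poly r \<xi>) / 2"
  have c: "c > 0" using r(2) by (simp add: c_def poly_eq_0_iff_dvd)
  have "isCont (poly r) \<xi>" by simp
  then obtain e where e: "e > 0" "\<And>x. dist x \<xi> < e \<Longrightarrow> dist (poly r x) (poly r \<xi>) < c"
    unfolding continuous_at_eps_delta using c by blast
  have "c * cmod (x - \<xi>) ^ order \<xi> P \<le> cmod (poly P x)" if "cmod (x - \<xi>) < e" for x
  proof -
    have "cmod (poly r \<xi>) - cmod (poly r x) < c"
      using e(2)[of x] that norm_triangle_ineq2[of "poly r \<xi>" "poly r x"]
      by (simp add: dist_norm norm_minus_commute)
    then have "c \<le> cmod (poly r x)" by (simp add: c_def)
    then have "c * cmod (x - \<xi>) ^ order \<xi> P \<le> cmod (poly r x) * cmod (x - \<xi>) ^ order \<xi> P"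
      by (rule mult_right_mono) simp
    also have "\<dots> = cmod (poly ([:- \<xi>, 1:] ^ order \<xi> P * r) x)"
      by (simp add: poly_power norm_mult norm_power mult.commute)
    finally show ?thesis unfolding r(1)[symmetric] .
  qed
  then show thesis using that c e(1) by blast
qed

section \<open>Division by the sum of the two polynomials\<close>

lemma poly_cpoly_of_real: "poly (cpoly p) (of_real x) = of_real (poly p x)"
  by (induction p) (simp_all add: map_poly_pCons)

lemma cpoly_nonzero: "p \<noteq> 0 \<Longrightarrow> cpoly p \<noteq> 0"
  by (simp add: map_poly_eq_0_iff)

lemma zero_mult_pos: "p \<noteq> 0 \<Longrightarrow> poly (cpoly p) \<xi> = 0 \<Longrightarrow> 0 < zero_mult p \<xi>"
  by (simp add: zero_mult_def order_root cpoly_nonzero)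

lemma ZR_zero_mult_pos:
  assumes "p \<noteq> 0" "q \<noteq> 0" "z \<in> ZR p q"
  shows "0 < zero_mult p (Re z)" "0 < zero_mult q (Im z)"
  using assms by (auto simp: ZR_def poly_cpoly_of_real intro!: zero_mult_pos)

lemma in_z_tensor: "in_z p = tensor (cpoly p) 1"
  by (simp add: in_z_def tensor_def map_poly_1)

lemma in_w_tensor: "in_w q = tensor 1 (cpoly q)"
  by (rule poly_eqI) (simp add: in_w_def coeff_tensor coeff_map_poly)

lemma pq_fun_regular:
  assumes "z \<notin> ZR p q"
  shows "pq_fun p q (Inl z) (0, 0) = of_real (poly p (Re z) + poly q (Im z))"
  using assms by (simp add: pq_fun_def in_z_tensor in_w_tensor poly_zw_tensor poly_cpoly_of_real)

text \<open>
  At a zero \<open>\<xi>\<close> of order \<open>m\<close> the coefficient \<open>p^(m)(\<xi>) / m!\<close> is nonzero, while \<open>q(w)\<close> does not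
  depend on \<open>z\<close> and contributes nothing to the index \<open>(m, 0)\<close>. So the coefficients at the two
  indices outside the rectangle can be divided by.
\<close>

lemma pq_fun_leading:
  assumes p: "p \<noteq> 0" and q: "q \<noteq> 0" and z: "z \<in> ZR p q"
  shows "pq_fun p q (Inl z) (zero_mult p (Re z), 0) \<noteq> 0"
    and "pq_fun p q (Inl z) (0, zero_mult q (Im z)) \<noteq> 0"
  using ZR_zero_mult_pos[OF assms] z taylor_order_nonzero[OF cpoly_nonzero[OF p]]
    taylor_order_nonzero[OF cpoly_nonzero[OF q]]
  by (simp_all add: pq_fun_def restrict_family_def I_A_def in_z_tensor in_w_tensor
      taylor_coeff_tensor taylor_one zero_mult_def)

text \<open>
  The points of \<open>ZR p q\<close> and \<open>Zi p q\<close> together are exactly the grid of pairs of complex zeros of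
  \<open>p\<close> and \<open>q\<close>; \<open>f\<close> collects the prescribed jets of both kinds.
\<close>

lemma poly_fun_interpolates:
  assumes p: "p \<noteq> 0" and q: "q \<noteq> 0"
  shows "\<exists>s. (\<forall>z\<in>ZR p q. \<forall>i\<in>I_B (zero_mult p (Re z)) (zero_mult q (Im z)).
        poly_fun p q s (Inl z) i = \<phi> (Inl z) i) \<and>
      (\<forall>(\<xi>, \<eta>)\<in>Zi p q. \<forall>i\<in>I_B (zero_mult p \<xi>) (zero_mult q \<eta>).
        poly_fun p q s (Inr (\<xi>, \<eta>)) i = \<phi> (Inr (\<xi>, \<eta>)) i)"
proof -
  define f where "f = (\<lambda>\<xi> \<eta> k l.
    if \<xi> \<in> \<real> \<and> \<eta> \<in> \<real> then \<phi> (Inl (Complex (Re \<xi>) (Re \<eta>))) (k, l) else \<phi> (Inr (\<xi>, \<eta>)) (k, l) :: complex)"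
  obtain s where s: "\<And>\<xi> \<eta> k l. k < zero_mult p \<xi> \<Longrightarrow> l < zero_mult q \<eta> \<Longrightarrow>
      taylor_coeff s k l \<xi> \<eta> = f \<xi> \<eta> k l"
    using hermite_interpolation[OF cpoly_nonzero[OF p] cpoly_nonzero[OF q], of f]
    unfolding zero_mult_def by blast
  have "poly_fun p q s (Inl z) i = \<phi> (Inl z) i"
    if "z \<in> ZR p q" "i \<in> I_B (zero_mult p (Re z)) (zero_mult q (Im z))" for z i
    using that by (auto simp: I_B_def I_A_def restrict_family_def s f_def)
  moreover have "poly_fun p q s (Inr (\<xi>, \<eta>)) i = \<phi> (Inr (\<xi>, \<eta>)) i"
    if "(\<xi>, \<eta>) \<in> Zi p q" "i \<in> I_B (zero_mult p \<xi>) (zero_mult q \<eta>)" for \<xi> \<eta> i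
    using that by (auto simp: I_B_def restrict_family_def s f_def Zi_def)
  ultimately show ?thesis by blast
qed

lemma poly_zw_continuous:
  "continuous_on A (\<lambda>z. poly_zw s (of_real (Re z)) (of_real (Im z)))"
proof -
  have "poly_zw s (of_real (Re z)) (of_real (Im z)) =
      (\<Sum>i\<le>degree s. poly (coeff s i) (of_real (Re z)) * poly (monom 1 i) (of_real (Im z)))" for z
    by (subst sum_tensor_monom[symmetric], unfold poly_zw_sum poly_zw_tensor) (rule refl)
  then show ?thesis by (simp only:) (intro continuous_intros)
qed

text \<open>
  The neighbourhoods are centred at all points of the compact set \<open>S\<close>, because \<open>A\<close> will be \<open>S\<close>
  without finitely many points and \<open>G\<close> could be unbounded near those.
\<close>

lemma bounded_image_compact_local:
  fixes G :: "'a::topological_space \<Rightarrow> 'b::metric_space"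
  assumes S: "compact S" and loc: "\<And>w. w \<in> S \<Longrightarrow> \<exists>U. open U \<and> w \<in> U \<and> bounded (G ` (A \<inter> U))"
    and A: "A \<subseteq> S"
  shows "bounded (G ` A)"
proof -
  have "\<forall>w. \<exists>U. w \<in> S \<longrightarrow> open U \<and> w \<in> U \<and> bounded (G ` (A \<inter> U))" using loc by blast
  from choice[OF this] obtain U where
    U: "\<And>w. w \<in> S \<Longrightarrow> open (U w) \<and> w \<in> U w \<and> bounded (G ` (A \<inter> U w))" by blast
  obtain D where D: "D \<subseteq> S" "finite D" "S \<subseteq> (\<Union>w\<in>D. U w)"
    by (rule compactE_image[OF S, of S U]) (use U in blast)+
  have "bounded (\<Union>w\<in>D. G ` (A \<inter> U w))" using D U by (intro bounded_UN) auto
  moreover have "G ` A \<subseteq> (\<Union>w\<in>D. G ` (A \<inter> U w))" using A D(3) by blast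
  ultimately show ?thesis by (rule bounded_subset)
qed

text \<open>
  Off \<open>ZR p q\<close> the larger of \<open>|p(Re z)|\<close> and \<open>|q(Im z)|\<close> is positive, and being continuous it
  stays away from zero nearby.
\<close>

lemma quotient_locally_bounded_regular:
  assumes w: "w \<notin> ZR p q"
    and dom: "\<And>z. z \<in> S \<Longrightarrow>
      max \<bar>poly p (Re z)\<bar> \<bar>poly q (Im z)\<bar> \<le> \<bar>poly p (Re z) + poly q (Im z)\<bar>"
    and f: "bounded (f ` (S - ZR p q))"
  shows "\<exists>U. open U \<and> w \<in> U \<and> bounded ((\<lambda>z. (f z - poly_zw s (Re z) (Im z)) /
      complex_of_real (poly p (Re z) + poly q (Im z))) ` ((S - ZR p q) \<inter> U))"
proof -
  define h where "h = (\<lambda>z. max \<bar>poly p (Re z)\<bar> \<bar>poly q (Im z)\<bar>)"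
  have hw: "h w > 0"
  proof (rule ccontr)
    assume "\<not> h w > 0"
    then have "poly p (Re w) = 0" "poly q (Im w) = 0" by (auto simp: h_def less_max_iff_disj)
    then have "w \<in> ZR p q" unfolding ZR_def by (intro CollectI exI[of _ "Re w"] exI[of _ "Im w"]) simp
    then show False using w by contradiction
  qed
  define U where "U = {z. h w / 2 < h z} \<inter> ball w 1"
  have "open U" unfolding U_def h_def by (intro open_Int open_Collect_less continuous_intros open_ball)
  moreover have "w \<in> U" using hw by (simp add: U_def)
  moreover have "compact ((\<lambda>z. poly_zw s (of_real (Re z)) (of_real (Im z))) ` cball w 1)"
    by (intro compact_continuous_image poly_zw_continuous compact_cball)
  then obtain C where C: "\<And>z. z \<in> cball w 1 \<Longrightarrow> cmod (poly_zw s (Re z) (Im z)) \<le> C"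
    using compact_imp_bounded bounded_iff by (metis (no_types, lifting) imageI)
  moreover obtain B where B: "\<And>z. z \<in> S - ZR p q \<Longrightarrow> cmod (f z) \<le> B"
    using f unfolding bounded_iff by blast
  have "cmod ((f z - poly_zw s (Re z) (Im z)) / complex_of_real (poly p (Re z) + poly q (Im z)))
      \<le> (B + C) / (h w / 2)" if z: "z \<in> (S - ZR p q) \<inter> U" for z
  proof -
    have "h w / 2 \<le> \<bar>poly p (Re z) + poly q (Im z)\<bar>"
    proof -
      have "h w / 2 < h z" using z by (simp add: U_def)
      also have "h z \<le> \<bar>poly p (Re z) + poly q (Im z)\<bar>" unfolding h_def using dom z by blast
      finally show ?thesis by simp
    qed
    moreover have "cmod (f z - poly_zw s (Re z) (Im z)) \<le> B + C"
      using norm_triangle_ineq4[of "f z" "poly_zw s (Re z) (Im z)"] B[of z] C[of z] z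
      by (force simp: U_def)
    ultimately show ?thesis
      unfolding norm_divide norm_of_real using hw by (intro frac_le) (auto intro: order_trans[OF norm_ge_zero])
  qed
  then have "bounded ((\<lambda>z. (f z - poly_zw s (Re z) (Im z)) /
      complex_of_real (poly p (Re z) + poly q (Im z))) ` ((S - ZR p q) \<inter> U))"
    unfolding bounded_iff by blast
  ultimately show ?thesis by blast
qed

text \<open>
  Here numerator and denominator both vanish at \<open>w\<close>. Let \<open>M\<close> be the larger of \<open>|Re (z - w)|^m\<close> and
  \<open>|Im (z - w)|^n\<close>. The function \<open>\<phi>\<close> and the interpolating polynomial have the same Taylor
  polynomial \<open>t\<close> at \<open>w\<close>, up to errors of size \<open>M\<close>; and \<open>p\<close>, \<open>q\<close> are bounded below by multiples of
  the two powers, so that the assumed lack of cancellation bounds \<open>p + q\<close> below by a multiple of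
  \<open>M\<close>.
\<close>

lemma quotient_locally_bounded_singular:
  assumes p: "p \<noteq> 0" and q: "q \<noteq> 0" and w: "w \<in> ZR p q"
    and dom: "\<And>z. z \<in> S \<Longrightarrow>
      max \<bar>poly p (Re z)\<bar> \<bar>poly q (Im z)\<bar> \<le> \<bar>poly p (Re z) + poly q (Im z)\<bar>"
    and quot: "open U" "w \<in> U" "bounded (quot p q \<phi> w ` (S \<inter> U - {w}))"
    and s: "\<And>k l. k < zero_mult p (Re w) \<Longrightarrow> l < zero_mult q (Im w) \<Longrightarrow>
      taylor_coeff s k l (Re w) (Im w) = \<phi> (Inl w) (k, l)"
  shows "\<exists>U. open U \<and> w \<in> U \<and> bounded ((\<lambda>z. (\<phi> (Inl z) (0, 0) - poly_zw s (Re z) (Im z)) /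
      complex_of_real (poly p (Re z) + poly q (Im z))) ` ((S - ZR p q) \<inter> U))"
proof -
  let ?m = "zero_mult p (Re w)" and ?n = "zero_mult q (Im w)"
  let ?x = "complex_of_real (Re w)" and ?y = "complex_of_real (Im w)"
  define M where "M = (\<lambda>z. max (\<bar>Re (z - w)\<bar> ^ ?m) (\<bar>Im (z - w)\<bar> ^ ?n))"
  define t where "t = (\<lambda>z. \<Sum>k<?m. \<Sum>l<?n.
      \<phi> (Inl w) (k, l) * of_real (Re (z - w)) ^ k * of_real (Im (z - w)) ^ l)"
  obtain K where K: "\<And>z. z \<in> S \<inter> U - {w} \<Longrightarrow> cmod (quot p q \<phi> w z) \<le> K"
    using quot(3) unfolding bounded_iff by blast
  obtain C where C: "\<And>z v. cmod (z - ?x) \<le> 1 \<Longrightarrow> cmod (v - ?y) \<le> 1 \<Longrightarrow>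
      cmod (poly_zw s z v - (\<Sum>k<?m. \<Sum>l<?n. taylor_coeff s k l ?x ?y * (z - ?x) ^ k * (v - ?y) ^ l))
        \<le> C * max (cmod (z - ?x) ^ ?m) (cmod (v - ?y) ^ ?n)"
    using taylor_remainder[where \<xi> = ?x and \<eta> = ?y and s = s and m = ?m and n = ?n] by blast
  obtain c e where ce: "c > 0" "e > 0"
    "\<And>x. cmod (x - ?x) < e \<Longrightarrow> c * cmod (x - ?x) ^ ?m \<le> cmod (poly (cpoly p) x)"
    by (rule poly_lower_bound[OF cpoly_nonzero[OF p], of ?x, folded zero_mult_def]) (rule that)
  obtain d r where dr: "d > 0" "r > 0"
    "\<And>y. cmod (y - ?y) < r \<Longrightarrow> d * cmod (y - ?y) ^ ?n \<le> cmod (poly (cpoly q) y)"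
    by (rule poly_lower_bound[OF cpoly_nonzero[OF q], of ?y, folded zero_mult_def]) (rule that)
  define V where "V = U \<inter> ball w (min 1 (min e r))"
  have "open V" "w \<in> V" using quot ce dr by (auto simp: V_def)
  moreover have "cmod ((\<phi> (Inl z) (0, 0) - poly_zw s (Re z) (Im z)) /
      complex_of_real (poly p (Re z) + poly q (Im z))) \<le> (K + C) / min c d"
    if z: "z \<in> (S - ZR p q) \<inter> V" for z
  proof -
    have zw: "z \<noteq> w" using z w by auto
    have "cmod (z - w) < min 1 (min e r)" using z by (simp add: V_def dist_norm norm_minus_commute)
    then have small: "\<bar>Re (z - w)\<bar> < min 1 (min e r)" "\<bar>Im (z - w)\<bar> < min 1 (min e r)"
      using abs_Re_le_cmod[of "z - w"] abs_Im_le_cmod[of "z - w"] by linarith+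
    have diff: "complex_of_real (Re z) - ?x = of_real (Re (z - w))"
        "complex_of_real (Im z) - ?y = of_real (Im (z - w))" by simp_all
    have M: "M z > 0" using zw by (auto simp: M_def less_max_iff_disj complex_eq_iff)
    have "cmod (\<phi> (Inl z) (0, 0) - t z) \<le> K * M z"
    proof -
      have "quot p q \<phi> w z = (\<phi> (Inl z) (0, 0) - t z) / of_real (M z)"
        by (simp only: quot_def t_def M_def)
      then have "cmod (\<phi> (Inl z) (0, 0) - t z) = cmod (quot p q \<phi> w z) * M z"
        using M by (simp add: norm_divide)
      also have "\<dots> \<le> K * M z" using K[of z] z zw M by (intro mult_right_mono) (auto simp: V_def)
      finally show ?thesis .
    qed
    moreover have "cmod (poly_zw s (Re z) (Im z) - t z) \<le> C * M z"
    proof -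
      have "(\<Sum>k<?m. \<Sum>l<?n. taylor_coeff s k l ?x ?y * (of_real (Re z) - ?x) ^ k * (of_real (Im z) - ?y) ^ l) = t z"
        unfolding t_def diff by (intro sum.cong refl) (simp add: s)
      then show ?thesis
        using C[of "of_real (Re z)" "of_real (Im z)"] small unfolding diff norm_of_real M_def by simp
    qed
    ultimately have num: "cmod (\<phi> (Inl z) (0, 0) - poly_zw s (Re z) (Im z)) \<le> (K + C) * M z"
      using norm_triangle_ineq4[of "\<phi> (Inl z) (0, 0) - t z" "poly_zw s (Re z) (Im z) - t z"]
      by (simp add: distrib_right)
    have "c * \<bar>Re (z - w)\<bar> ^ ?m \<le> \<bar>poly p (Re z)\<bar>"
      using ce(3)[of "of_real (Re z)"] small unfolding diff poly_cpoly_of_real norm_of_real by simp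
    moreover have "d * \<bar>Im (z - w)\<bar> ^ ?n \<le> \<bar>poly q (Im z)\<bar>"
      using dr(3)[of "of_real (Im z)"] small unfolding diff poly_cpoly_of_real norm_of_real by simp
    moreover have "min c d * \<bar>Re (z - w)\<bar> ^ ?m \<le> c * \<bar>Re (z - w)\<bar> ^ ?m"
      "min c d * \<bar>Im (z - w)\<bar> ^ ?n \<le> d * \<bar>Im (z - w)\<bar> ^ ?n"
      by (intro mult_right_mono; simp)+
    ultimately have "min c d * M z \<le> max \<bar>poly p (Re z)\<bar> \<bar>poly q (Im z)\<bar>"
      by (auto simp: M_def max_def)
    also have "\<dots> \<le> \<bar>poly p (Re z) + poly q (Im z)\<bar>" using dom z by blast
    finally have den: "min c d * M z \<le> \<bar>poly p (Re z) + poly q (Im z)\<bar>" .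
    have "cmod ((\<phi> (Inl z) (0, 0) - poly_zw s (Re z) (Im z)) / complex_of_real (poly p (Re z) + poly q (Im z)))
        \<le> ((K + C) * M z) / (min c d * M z)"
      unfolding norm_divide norm_of_real using num den M ce(1) dr(1)
      by (intro frac_le) (auto intro: order_trans[OF norm_ge_zero])
    then show ?thesis using M by simp
  qed
  then have "bounded ((\<lambda>z. (\<phi> (Inl z) (0, 0) - poly_zw s (Re z) (Im z)) /
      complex_of_real (poly p (Re z) + poly q (Im z))) ` ((S - ZR p q) \<inter> V))"
    unfolding bounded_iff by blast
  ultimately show ?thesis by blast
qed

text \<open>
  Given the interpolating polynomial \<open>s\<close>, the required identity determines \<open>g\<close>: off \<open>ZR p q\<close> it is
  the quotient of \<open>\<phi> - s\<close> by \<open>p + q\<close>, and on \<open>ZR p q\<close> the two entries outside the rectangle give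
  one scalar equation for each component. Compactness of \<open>S\<close> turns the local bounds into a global
  one.
\<close>

theorem F_fun_decomposition:
  assumes p: "p \<noteq> 0" and q: "q \<noteq> 0" and S: "compact S"
    and dom: "\<And>z. z \<in> S \<Longrightarrow>
      max \<bar>poly p (Re z)\<bar> \<bar>poly q (Im z)\<bar> \<le> \<bar>poly p (Re z) + poly q (Im z)\<bar>"
    and \<phi>: "\<phi> \<in> F_fun p q S"
  shows "\<exists>s g. (\<lambda>z i. \<phi> z i - poly_fun p q s z i) \<in> R_fun p q S \<and>
    (\<forall>z \<in> S - ZR p q. g z \<in> range Inl) \<and>
    (\<forall>z \<in> S \<inter> ZR p q. g z \<in> range Inr) \<and>
    bounded ((\<lambda>z. projl (g z)) ` (S - ZR p q)) \<and>
    (\<lambda>z. projl (g z)) \<in> borel_measurable (restrict_space borel (S - ZR p q)) \<and>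
    (\<forall>z \<in> S. \<forall>i. \<phi> (Inl z) i = poly_fun p q s (Inl z) i + pq_times p q z (g z) i)"
proof -
  have \<phi>M: "\<phi> \<in> M_fun p q S"
    and \<phi>_meas: "(\<lambda>z. \<phi> (Inl z) (0, 0)) \<in> borel_measurable (restrict_space borel (S - ZR p q))"
    and \<phi>_bdd: "bounded ((\<lambda>z. \<phi> (Inl z) (0, 0)) ` (S - ZR p q))"
    and \<phi>_quot: "\<And>w. w \<in> S \<inter> ZR p q \<Longrightarrow> \<exists>U. open U \<and> U \<inter> ZR p q = {w} \<and>
      bounded (quot p q \<phi> w ` (S \<inter> U - {w}))"
    using \<phi> unfolding F_fun_def by blast+
  have \<phi>_vanish: "\<phi> z i = 0" if "z \<in> (S \<union> ZR p q) <+> Zi p q" "i \<notin> index_set p q z" for z i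
    using \<phi>M that unfolding M_fun_def families_def by blast
  obtain s where
    s_ZR: "\<And>z i. z \<in> ZR p q \<Longrightarrow> i \<in> I_B (zero_mult p (Re z)) (zero_mult q (Im z)) \<Longrightarrow>
      poly_fun p q s (Inl z) i = \<phi> (Inl z) i"
    and s_Zi: "\<And>\<xi> \<eta> i. (\<xi>, \<eta>) \<in> Zi p q \<Longrightarrow> i \<in> I_B (zero_mult p \<xi>) (zero_mult q \<eta>) \<Longrightarrow>
      poly_fun p q s (Inr (\<xi>, \<eta>)) i = \<phi> (Inr (\<xi>, \<eta>)) i"
    using poly_fun_interpolates[OF p q, of \<phi>] by blast
  have poly_vanish: "poly_fun p q s z i = 0" if "i \<notin> index_set p q z" for z i
    using that by (cases "(p, q, z)" rule: index_set.cases) (auto simp: restrict_family_def)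
  have diff_R: "(\<lambda>z i. \<phi> z i - poly_fun p q s z i) \<in> R_fun p q S"
    unfolding R_fun_def
  proof (intro CollectI conjI ballI)
    show "(\<lambda>z i. \<phi> z i - poly_fun p q s z i) \<in> M_fun p q S"
      unfolding M_fun_def families_def using \<phi>_vanish poly_vanish by auto
    fix z assume "z \<in> ZR p q <+> Zi p q"
    then consider x where "z = Inl x" "x \<in> ZR p q" | \<xi> \<eta> where "z = Inr (\<xi>, \<eta>)" "(\<xi>, \<eta>) \<in> Zi p q"
      by auto
    then show "proj_family p q z (\<lambda>i. \<phi> z i - poly_fun p q s z i) = (\<lambda>_. 0)"
    proof cases
      case 1
      then show ?thesis using s_ZR[OF 1(2)]
        by (auto simp: restrict_family_def fun_eq_iff simp del: poly_fun.simps)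
    next
      case 2
      then show ?thesis using s_Zi[OF 2(2)]
        by (auto simp: restrict_family_def fun_eq_iff simp del: poly_fun.simps)
    qed
  qed
  define h where "h = (\<lambda>z. complex_of_real (poly p (Re z) + poly q (Im z)))"
  define G where "G = (\<lambda>z. (\<phi> (Inl z) (0, 0) - poly_zw s (Re z) (Im z)) / h z)"
  define c1 where "c1 = (\<lambda>z. let i = (zero_mult p (Re z), 0) in
    (\<phi> (Inl z) i - poly_fun p q s (Inl z) i) / pq_fun p q (Inl z) i)"
  define c2 where "c2 = (\<lambda>z. let i = (0, zero_mult q (Im z)) in
    (\<phi> (Inl z) i - poly_fun p q s (Inl z) i) / pq_fun p q (Inl z) i)"
  define g where "g = (\<lambda>z. if z \<in> ZR p q then Inr (c1 z, c2 z) else Inl (G z))"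
  have G_bdd: "bounded (G ` (S - ZR p q))"
  proof (rule bounded_image_compact_local[OF S])
    fix w assume w: "w \<in> S"
    show "\<exists>U. open U \<and> w \<in> U \<and> bounded (G ` ((S - ZR p q) \<inter> U))"
    proof (cases "w \<in> ZR p q")
      case False
      show ?thesis unfolding G_def h_def
        by (rule quotient_locally_bounded_regular[OF False dom \<phi>_bdd])
    next
      case True
      obtain U where U: "open U" "U \<inter> ZR p q = {w}" "bounded (quot p q \<phi> w ` (S \<inter> U - {w}))"
        using \<phi>_quot[of w] w True by blast
      have wU: "w \<in> U" using U(2) by blast
      have "taylor_coeff s k l (Re w) (Im w) = \<phi> (Inl w) (k, l)"
        if "k < zero_mult p (Re w)" "l < zero_mult q (Im w)" for k l
        using s_ZR[OF True, of "(k, l)"] that True by (simp add: I_B_def I_A_def restrict_family_def)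
      then show ?thesis unfolding G_def h_def
        by (intro quotient_locally_bounded_singular[OF p q True dom U(1) wU U(3)])
    qed
  qed simp
  have "h \<in> borel_measurable (restrict_space borel (S - ZR p q))"
    unfolding h_def by (intro measurable_restrict_space1 borel_measurable_continuous_onI continuous_intros)
  moreover have "(\<lambda>z. poly_zw s (Re z) (Im z)) \<in> borel_measurable (restrict_space borel (S - ZR p q))"
    by (intro measurable_restrict_space1 borel_measurable_continuous_onI poly_zw_continuous)
  ultimately have G_meas: "G \<in> borel_measurable (restrict_space borel (S - ZR p q))"
    unfolding G_def using \<phi>_meas by (intro borel_measurable_divide borel_measurable_diff)
  have gG: "projl (g z) = G z" if "z \<notin> ZR p q" for z using that by (simp add: g_def)
  have g_bdd: "bounded ((\<lambda>z. projl (g z)) ` (S - ZR p q))"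
    by (rule bounded_subset[OF G_bdd]) (auto simp: gG)
  have g_meas: "(\<lambda>z. projl (g z)) \<in> borel_measurable (restrict_space borel (S - ZR p q))"
    using G_meas by (rule measurable_cong[THEN iffD2, rotated]) (simp add: gG space_restrict_space)
  have eq: "\<phi> (Inl z) i = poly_fun p q s (Inl z) i + pq_times p q z (g z) i" if z: "z \<in> S" for z i
  proof (cases "z \<in> ZR p q")
    case False
    have "h z \<noteq> 0"
    proof
      assume "h z = 0"
      then have "poly p (Re z) + poly q (Im z) = 0" unfolding h_def of_real_eq_0_iff .
      then have "poly p (Re z) = 0" "poly q (Im z) = 0" using dom[OF z] by auto
      then have "z \<in> ZR p q" unfolding ZR_def by (intro CollectI exI[of _ "Re z"] exI[of _ "Im z"]) simp
      then show False using False by contradiction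
    qed
    moreover have "pq_fun p q (Inl z) (0, 0) = h z"
      unfolding h_def by (rule pq_fun_regular[OF False])
    ultimately show ?thesis
      using False \<phi>_vanish[of "Inl z" i] z by (auto simp: g_def G_def)
  next
    case True
    let ?m = "zero_mult p (Re z)" and ?n = "zero_mult q (Im z)"
    note pos = ZR_zero_mult_pos[OF p q True] and lead = pq_fun_leading[OF p q True]
    have g: "g z = Inr (c1 z, c2 z)" using True by (simp add: g_def)
    consider "i \<in> I_B ?m ?n" | "i = (?m, 0)" | "i = (0, ?n)" | "i \<notin> index_set p q (Inl z)"
      using True by (auto simp: I_A_def I_B_def)
    then show ?thesis
    proof cases
      case 1
      then have "i \<noteq> (?m, 0)" "i \<noteq> (0, ?n)" by (auto simp: I_B_def)
      then have "pq_times p q z (g z) i = 0" by (simp add: g Let_def)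
      then show ?thesis unfolding s_ZR[OF True 1] by simp
    next
      case 2
      then have "pq_times p q z (g z) i = \<phi> (Inl z) i - poly_fun p q s (Inl z) i"
        using lead(1) unfolding g by (simp add: Let_def c1_def del: poly_fun.simps)
      then show ?thesis by (simp del: poly_fun.simps)
    next
      case 3
      then have "pq_times p q z (g z) i = \<phi> (Inl z) i - poly_fun p q s (Inl z) i"
        using lead(2) pos unfolding g by (simp add: Let_def c2_def del: poly_fun.simps)
      then show ?thesis by (simp del: poly_fun.simps)
    next
      case 4
      then have "i \<noteq> (?m, 0)" "i \<noteq> (0, ?n)" using True by (auto simp: I_A_def)
      then have "pq_times p q z (g z) i = 0" by (simp add: g Let_def)
      then show ?thesis
        using \<phi>_vanish[OF InlI[OF UnI1[OF z]] 4] poly_vanish[OF 4] by (simp del: poly_fun.simps)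
    qed
  qed
  show ?thesis
    using diff_R g_bdd g_meas eq
    by (intro exI[of _ s] exI[of _ g] conjI) (auto simp: g_def)
qed

theorem lemma5p1:
  fixes N :: "'k::krein_space \<Rightarrow> 'k"
    and p q :: "real poly"
    and T1 :: "'v1::complex_hilbert_space \<Rightarrow> 'k"
    and T2 :: "'v2::complex_hilbert_space \<Rightarrow> 'k"
    and T :: "'v::complex_hilbert_space \<Rightarrow> 'k"
    and \<sigma> :: "complex set"
    and \<phi> :: "point \<Rightarrow> family"
  assumes "normal_op N"
    and "p \<noteq> 0" and "nonneg_op (op_poly p (real_part N))"
    and "q \<noteq> 0" and "nonneg_op (op_poly q (imag_part N))"
    and "bounded_clinear T1" and "inj T1" and "T1 \<circ> adj T1 = op_poly p (real_part N)"
    and "bounded_clinear T2" and "inj T2" and "T2 \<circ> adj T2 = op_poly q (imag_part N)"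
    and "bounded_clinear T" and "inj T"
    and "T \<circ> adj T = (\<lambda>x. op_poly p (real_part N) x + op_poly q (imag_part N) x)"
    and \<sigma>: "\<sigma> = op_spectrum (Theta T N)"
    and "\<phi> \<in> F_fun p q \<sigma>"
  shows "\<exists>(s :: complex poly poly) (g :: complex \<Rightarrow> complex + complex \<times> complex).
    (\<lambda>z i. \<phi> z i - poly_fun p q s z i) \<in> R_fun p q \<sigma> \<and>
    (\<forall>z \<in> \<sigma> - ZR p q. g z \<in> range Inl) \<and>
    (\<forall>z \<in> \<sigma> \<inter> ZR p q. g z \<in> range Inr) \<and>
    bounded ((\<lambda>z. projl (g z)) ` (\<sigma> - ZR p q)) \<and>
    (\<lambda>z. projl (g z)) \<in> borel_measurable (restrict_space borel (\<sigma> - ZR p q)) \<and>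
    (\<forall>z \<in> \<sigma>. \<forall>i. \<phi> (Inl z) i = poly_fun p q s (Inl z) i + pq_times p q z (g z) i)"
proof -
  note spec = spectrum_Theta[OF assms(1,3,5,6,8,9,11,12,13,14), folded \<sigma>]
  show ?thesis by (rule F_fun_decomposition[OF assms(2,4) spec assms(16)])
qed

end
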